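(* Let $N\ge 2$, let $m_0$ be a non-singular wavelet filter of order $N$, and let $h\in L^1(\mathbb{T})$, $h\ge0$, $h\ne0$, satisfy $R_{m_0}(h)=h$. Then the operator $S_0\xi(z)=m_0(z)\xi(z^N)$, $\xi\in L^2(h)$, satisfies $$\bigcap_{n=1}^\infty S_0^n\bigl(L^2(h)\bigr)=\{0\}.$$ If $U$ is the unitary operator in $\mathcal{H}_h$ with $U\pi(f)U^{-1}=\pi(f(z^N))$ which defines the $h$-induced cyclic representation, i.e., $U\varphi=\pi(m_0)\varphi$ with $\varphi$ denoting the cyclic vector, then $$\bigcap_{n=1}^\infty U^n\bigl(V_0(\varphi)\bigr)=\{0\},$$ where $V_0(\varphi):=\overline{\operatorname{span}}\{\pi(f)\varphi : f\in L^\infty(\mathbb{T})\}$.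
   Context: $\mathbb{T}$ is the unit circle with normalized Haar measure $\mu$. A wavelet filter of order $N$ is a function $m_0\in L^\infty(\mathbb{T})$ such that $\sum_{k=0}^{N-1}|m_0(e^{i2\pi k/N}z)|^2=N$ for a.a. $z$, $m_0$ is continuous near $z=1$, and $m_0(1)=\sqrt N$. A measurable function on $\mathbb{T}$ is non-singular if it does not vanish on a subset of $\mathbb{T}$ of positive Lebesgue measure. $(R_{m_0}f)(z)=\frac1N\sum_{w^N=z}|m_0(w)|^2f(w)$ for $f\in L^1(\mathbb{T})$. $L^2(h):=L^2(\mathbb{T},h\,d\mu)$. The $h$-induced cyclic representation is the triple $(\mathcal{H}_h,\pi,U)$ with cyclic vector $\varphi$, unique up to unitary equivalence, where $\pi$ is a representation of $L^\infty(\mathbb{T})$ on the Hilbert space $\mathcal{H}_h$, $U$ is a unitary operator on $\mathcal{H}_h$ with $U\pi(f)U^{-1}=\pi(f(z^N))$, $\varphi$ is cyclic for the algebra generated by $\pi(L^\infty(\mathbb{T}))$, $U$ and $U^{-1}$, $\langle\varphi,\pi(f)\varphi\rangle=\int_{\mathbb{T}}fh\,d\mu$ for $f\in L^\infty(\mathbb{T})$, and $U\varphi=\pi(m_0)\varphi$. *)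

theory Defs
  imports "HOL-Analysis.Analysis"
begin

section \<open>Functions on the unit circle\<close>

text \<open>Functions on the circle are represented by functions on \<^typ>\<open>complex\<close>; values off the
  circle are irrelevant, since the measure space below has carrier \<^term>\<open>sphere (0::complex) 1\<close>.\<close>

definition circle_measure :: "complex measure" where
  "circle_measure =
     distr (uniform_measure lborel {0..<1::real}) (restrict_space borel (sphere 0 1))
           (\<lambda>t. cis (2 * pi * t))"

definition Linf :: "(complex \<Rightarrow> complex) set" where
  "Linf = {f \<in> borel_measurable circle_measure. \<exists>C. AE z in circle_measure. cmod (f z) \<le> C}"

definition wavelet_filter :: "nat \<Rightarrow> (complex \<Rightarrow> complex) \<Rightarrow> bool" where
  "wavelet_filter N m0 \<longleftrightarrow>
     m0 \<in> Linf \<and>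
     (AE z in circle_measure.
        (\<Sum>k<(N::nat). (cmod (m0 (exp (\<i> * of_real (2 * pi * real k / real N)) * z)))\<^sup>2) = real N) \<and>
     (\<exists>e>0. continuous_on (sphere 0 1 \<inter> ball 1 e) m0) \<and>
     m0 1 = complex_of_real (sqrt (real N))"

definition nonsingular :: "(complex \<Rightarrow> complex) \<Rightarrow> bool" where
  "nonsingular f \<longleftrightarrow>
     f \<in> borel_measurable circle_measure \<and>
     \<not> (\<exists>A \<in> sets circle_measure. emeasure circle_measure A > 0 \<and> (\<forall>z\<in>A. f z = 0))"

definition ruelle :: "nat \<Rightarrow> (complex \<Rightarrow> complex) \<Rightarrow> (complex \<Rightarrow> 'b::real_vector) \<Rightarrow> complex \<Rightarrow> 'b"
  where "ruelle N m0 f z = (1 / real N) *\<^sub>R (\<Sum>w | w ^ N = z. (cmod (m0 w))\<^sup>2 *\<^sub>R f w)"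


section \<open>The space \<open>L\<^sup>2(h)\<close> and the operator \<open>S\<^sub>0\<close>\<close>

definition weighted :: "(complex \<Rightarrow> real) \<Rightarrow> complex measure" where
  "weighted h = density circle_measure (\<lambda>z. ennreal (h z))"

definition square_integrable :: "(complex \<Rightarrow> real) \<Rightarrow> (complex \<Rightarrow> complex) set" where
  "square_integrable h =
     {f \<in> borel_measurable (weighted h). integrable (weighted h) (\<lambda>z. (cmod (f z))\<^sup>2)}"

definition ae_rel :: "(complex \<Rightarrow> real) \<Rightarrow> ((complex \<Rightarrow> complex) \<times> (complex \<Rightarrow> complex)) set" where
  "ae_rel h = {(f, g). f \<in> square_integrable h \<and> g \<in> square_integrable h \<and>
                       (AE z in weighted h. f z = g z)}"

lemma equiv_ae_rel: "equiv (square_integrable h) (ae_rel h)"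
proof (rule equivI)
  show "ae_rel h \<subseteq> square_integrable h \<times> square_integrable h"
    by (auto simp: ae_rel_def)
  show "refl_on (square_integrable h) (ae_rel h)"
    by (auto simp: refl_on_def ae_rel_def)
  show "sym (ae_rel h)"
    by (auto simp: sym_def ae_rel_def eq_commute)
  show "trans (ae_rel h)"
    unfolding trans_def ae_rel_def by (auto elim: AE_mp)
qed

definition L2 :: "(complex \<Rightarrow> real) \<Rightarrow> (complex \<Rightarrow> complex) set set" where
  "L2 h = square_integrable h // ae_rel h"

definition L2_class :: "(complex \<Rightarrow> real) \<Rightarrow> (complex \<Rightarrow> complex) \<Rightarrow> (complex \<Rightarrow> complex) set" where
  "L2_class h f = ae_rel h `` {f}"

text \<open>The operator acts on classes: the image of the class of \<open>\<xi>\<close> consists of the functions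
  equal almost everywhere to \<open>m\<^sub>0(z) \<xi>(z\<^sup>N)\<close>.\<close>

definition S0 :: "nat \<Rightarrow> (complex \<Rightarrow> complex) \<Rightarrow> (complex \<Rightarrow> real) \<Rightarrow>
    (complex \<Rightarrow> complex) set \<Rightarrow> (complex \<Rightarrow> complex) set" where
  "S0 N m0 h C = ae_rel h `` ((\<lambda>\<xi> z. m0 z * \<xi> (z ^ N)) ` C)"


section \<open>Complex Hilbert spaces\<close>

text \<open>The inner product is linear in the second variable. The real inner product, which
  provides norm and topology, is its real part.\<close>

class complex_hilbert_space = real_inner + complete_space +
  fixes scaleC :: "complex \<Rightarrow> 'a \<Rightarrow> 'a" (infixr "*\<^sub>C" 75)
    and cinner :: "'a \<Rightarrow> 'a \<Rightarrow> complex"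
  assumes scaleC_add_right: "c *\<^sub>C (x + y) = c *\<^sub>C x + c *\<^sub>C y"
    and scaleC_add_left: "(c + d) *\<^sub>C x = c *\<^sub>C x + d *\<^sub>C x"
    and scaleC_scaleC: "c *\<^sub>C (d *\<^sub>C x) = (c * d) *\<^sub>C x"
    and scaleC_of_real: "complex_of_real r *\<^sub>C x = r *\<^sub>R x"
    and cinner_commute: "cinner x y = cnj (cinner y x)"
    and cinner_add_right: "cinner x (y + z) = cinner x y + cinner x z"
    and cinner_scaleC_right: "cinner x (c *\<^sub>C y) = c * cinner x y"
    and Re_cinner: "Re (cinner x y) = inner x y"

lemma vector_space_scaleC:
  "vector_space (scaleC :: complex \<Rightarrow> 'a::complex_hilbert_space \<Rightarrow> 'a)"
proof
  show "1 *\<^sub>C x = x" for x :: 'a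
    using scaleC_of_real[of 1 x] by simp
qed (simp_all add: scaleC_add_right scaleC_add_left scaleC_scaleC)

definition bounded_clinear :: "('v::complex_hilbert_space \<Rightarrow> 'v) \<Rightarrow> bool" where
  "bounded_clinear T \<longleftrightarrow> bounded_linear T \<and> (\<forall>c x. T (c *\<^sub>C x) = c *\<^sub>C T x)"

definition unitary_op :: "('v::complex_hilbert_space \<Rightarrow> 'v) \<Rightarrow> bool" where
  "unitary_op U \<longleftrightarrow> bounded_clinear U \<and> surj U \<and> (\<forall>x y. cinner (U x) (U y) = cinner x y)"

inductive_set generated_algebra ::
    "('v::complex_hilbert_space \<Rightarrow> 'v) set \<Rightarrow> ('v \<Rightarrow> 'v) set" for G where
  gen: "T \<in> G \<Longrightarrow> T \<in> generated_algebra G"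
| add: "S \<in> generated_algebra G \<Longrightarrow> T \<in> generated_algebra G \<Longrightarrow>
          (\<lambda>x. S x + T x) \<in> generated_algebra G"
| scale: "T \<in> generated_algebra G \<Longrightarrow> (\<lambda>x. c *\<^sub>C T x) \<in> generated_algebra G"
| comp: "S \<in> generated_algebra G \<Longrightarrow> T \<in> generated_algebra G \<Longrightarrow> S \<circ> T \<in> generated_algebra G"


section \<open>The \<open>h\<close>-induced cyclic representation\<close>

text \<open>The first axiom makes \<open>\<pi>\<close> a map on almost-everywhere classes; the others make it a
  unital star-representation.\<close>

locale Linf_representation =
  fixes \<pi> :: "(complex \<Rightarrow> complex) \<Rightarrow> ('v::complex_hilbert_space \<Rightarrow> 'v)"
  assumes rep_cong: "\<lbrakk>f \<in> Linf; g \<in> Linf; AE z in circle_measure. f z = g z\<rbrakk> \<Longrightarrow> \<pi> f = \<pi> g"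
    and rep_bounded: "f \<in> Linf \<Longrightarrow> bounded_clinear (\<pi> f)"
    and rep_add: "\<lbrakk>f \<in> Linf; g \<in> Linf\<rbrakk> \<Longrightarrow> \<pi> (\<lambda>z. f z + g z) = (\<lambda>x. \<pi> f x + \<pi> g x)"
    and rep_scale: "f \<in> Linf \<Longrightarrow> \<pi> (\<lambda>z. c * f z) = (\<lambda>x. c *\<^sub>C \<pi> f x)"
    and rep_mult: "\<lbrakk>f \<in> Linf; g \<in> Linf\<rbrakk> \<Longrightarrow> \<pi> (\<lambda>z. f z * g z) = \<pi> f \<circ> \<pi> g"
    and rep_one: "\<pi> (\<lambda>z. 1) = id"
    and rep_star: "f \<in> Linf \<Longrightarrow> cinner (\<pi> f x) y = cinner x (\<pi> (\<lambda>z. cnj (f z)) y)"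

locale induced_cyclic_representation = Linf_representation \<pi>
  for N :: nat and m0 :: "complex \<Rightarrow> complex" and h :: "complex \<Rightarrow> real"
    and \<pi> :: "(complex \<Rightarrow> complex) \<Rightarrow> ('v::complex_hilbert_space \<Rightarrow> 'v)"
    and U :: "'v \<Rightarrow> 'v" and \<phi> :: 'v +
  assumes unitary: "unitary_op U"
    and covariance: "f \<in> Linf \<Longrightarrow> U \<circ> \<pi> f \<circ> inv U = \<pi> (\<lambda>z. f (z ^ N))"
    and cyclic: "closure {T \<phi> | T. T \<in> generated_algebra (\<pi> ` Linf \<union> {U, inv U})} = UNIV"
    and state: "f \<in> Linf \<Longrightarrow> cinner \<phi> (\<pi> f \<phi>) = (LINT z|circle_measure. f z * complex_of_real (h z))"
    and scaling: "U \<phi> = \<pi> m0 \<phi>"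

definition V0 :: "((complex \<Rightarrow> complex) \<Rightarrow> ('v::complex_hilbert_space \<Rightarrow> 'v)) \<Rightarrow> 'v \<Rightarrow> 'v set" where
  "V0 \<pi> \<phi> = closure (module.span scaleC {\<pi> f \<phi> | f. f \<in> Linf})"

end

theory Submission
  imports Defs "HOL-Complex_Analysis.Cauchy_Integral_Theorem"
begin

text \<open>
Write \<open>\<sigma> z = z ^ N\<close> and let \<open>P f z\<close> be the average of \<open>f\<close> over the \<open>N\<close>-th roots of \<open>z\<close>.
An element of the intersection of the ranges is the start of a backward orbit \<open>\<xi>\<^sub>n\<close> in
\<open>L\<^sup>2(h)\<close> with \<open>\<xi>\<^sub>n = m\<^sub>0 (\<xi>\<^sub>n\<^sub>+\<^sub>1 \<circ> \<sigma>)\<close>. The identity \<open>P (f (g \<circ> \<sigma>)) = (P f) g\<close> and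
\<open>R h = h\<close> say that the densities \<open>f\<^sub>n = h \<bar>\<xi>\<^sub>n\<bar>\<^sup>2\<close> satisfy \<open>P f\<^sub>n = f\<^sub>n\<^sub>+\<^sub>1\<close>. The power map is exact:
averages over all \<open>M\<close>-th roots tend in \<open>L\<^sup>1\<close> to the mean as \<open>M\<close> grows
(\<open>transfer_equidistributes\<close>, which is \<open>L\<^sup>1\<close>-convergence of shifted Riemann sums). Hence \<open>f\<^sub>n\<close>
tends in \<open>L\<^sup>1\<close> to the constant \<open>c = \<parallel>\<xi>\<^sub>0\<parallel>\<^sup>2\<close>.

Suppose \<open>c > 0\<close>. Then \<open>h > 0\<close> almost everywhere, because every \<open>f\<^sub>n\<close> vanishes where \<open>h\<close> does.
The orbit relation reads \<open>f\<^sub>n (h \<circ> \<sigma>) = \<bar>m\<^sub>0\<bar>\<^sup>2 h (f\<^sub>n\<^sub>+\<^sub>1 \<circ> \<sigma>)\<close>, and the limit along an almost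
everywhere convergent subsequence gives \<open>h \<circ> \<sigma> = \<bar>m\<^sub>0\<bar>\<^sup>2 h\<close>. Together with the filter identity
\<open>P \<bar>m\<^sub>0\<bar>\<^sup>2 = 1\<close> this makes \<open>1/h\<close> a fixed point of \<open>P\<close>. Truncations of \<open>1/h\<close> are then integrable
fixed points, hence constant by exactness; so \<open>h\<close> is constant and \<open>\<bar>m\<^sub>0\<bar> = 1\<close> almost everywhere.
Continuity of \<open>m\<^sub>0\<close> near \<open>1\<close> with \<open>m\<^sub>0(1) = \<surd>N > 1\<close> excludes this (\<open>no_coboundary\<close>). Thus \<open>c = 0\<close>
and the orbit vanishes (\<open>backward_orbit_vanishes\<close>).

For \<open>S\<^sub>0\<close>, which is isometric, this is the claim. In a cyclic representation,
\<open>\<parallel>\<pi>(f)\<phi>\<parallel>\<^sup>2 = \<integral> \<bar>f\<bar>\<^sup>2 h\<close> and \<open>U \<pi>(f)\<phi> = \<pi>(m\<^sub>0 (f \<circ> \<sigma>))\<phi>\<close>, so vectors of \<open>V\<^sub>0(\<phi>)\<close> correspond to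
elements of \<open>L\<^sup>2(h)\<close>, by completeness of the latter, in such a way that \<open>U\<close> acts as \<open>S\<^sub>0\<close>. A
vector in all \<open>U\<^sup>n V\<^sub>0(\<phi>)\<close> therefore also yields a backward orbit.
\<close>

section \<open>Shifted Riemann sums\<close>

abbreviation unit_interval :: "real measure" where
  "unit_interval \<equiv> uniform_measure lborel {0..<1}"

definition riemann_sum :: "nat \<Rightarrow> (real \<Rightarrow> real) \<Rightarrow> real \<Rightarrow> real" where
  "riemann_sum M F s = (\<Sum>k<M. F ((s + real k) / real M)) / real M"

interpretation unit_interval: finite_measure unit_interval
  by (rule finite_measureI) simp

lemma nn_integral_unit_interval:
  assumes "F \<in> borel_measurable borel"
  shows "(\<integral>\<^sup>+s. F s \<partial>unit_interval) = (\<integral>\<^sup>+s. F s * indicator {0..<1} s \<partial>lborel)"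
  using assms by (simp add: nn_integral_uniform_measure divide_ennreal_def)

lemma indicator_consecutive_intervals:
  assumes "M > 0"
  shows "(\<Sum>k<m. indicator {real k / real M..<(1 + real k) / real M} x :: ennreal)
    = indicator {0..<real m / real M} x"
proof (induction m)
  case (Suc m)
  have "real m / real M \<le> (1 + real m) / real M"
    by (auto simp: divide_right_mono)
  moreover have "0 \<le> x" if "real m / real M \<le> x"
    using that by (meson divide_nonneg_nonneg of_nat_0_le_iff order_trans)
  ultimately have "indicator {0..<real m / real M} x + indicator {real m / real M..<(1 + real m) / real M} x
      = (indicator {0..<real (Suc m) / real M} x :: ennreal)"
    by (cases "x < real m / real M"; cases "0 \<le> x") (auto simp: indicator_def)
  moreover have "(\<Sum>k<Suc m. indicator {real k / real M..<(1 + real k) / real M} x :: ennreal)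
      = indicator {0..<real m / real M} x + indicator {real m / real M..<(1 + real m) / real M} x"
    using Suc by simp
  ultimately show ?case by simp
qed auto

text \<open>Cutting \<open>[0,1)\<close> into \<open>M\<close> equal pieces and rescaling each of them to \<open>[0,1)\<close>: averaging over
the pieces preserves the integral.\<close>

lemma nn_integral_average:
  fixes F :: "real \<Rightarrow> ennreal"
  assumes [measurable]: "F \<in> borel_measurable borel" and "M > 0"
  shows "(\<integral>\<^sup>+s. (\<Sum>k<M. F ((s + real k) / real M)) * ennreal (1 / real M) \<partial>unit_interval)
    = (\<integral>\<^sup>+s. F s \<partial>unit_interval)"
proof -
  have piece: "(\<integral>\<^sup>+s. F s * indicator {real k / real M..<(1 + real k) / real M} s \<partial>lborel)
      = ennreal (1 / real M) * (\<integral>\<^sup>+s. F ((s + real k) / real M) \<partial>unit_interval)" for k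
  proof -
    have ind: "indicator {real k / real M..<(1 + real k) / real M} (real k / real M + (1 / real M) * s)
        = (indicator {0..<1} s :: ennreal)" for s
      using \<open>M > 0\<close> by (auto simp: indicator_def field_simps)
    have arg: "real k / real M + (1 / real M) * s = (s + real k) / real M" for s
      by (simp add: add_divide_distrib)
    show ?thesis
      using \<open>M > 0\<close>
      by (subst nn_integral_real_affine[where t = "real k / real M" and c = "1 / real M"])
         (simp_all only: ind, simp_all add: arg[simplified] nn_integral_unit_interval)
  qed
  have "(\<integral>\<^sup>+s. F s \<partial>unit_interval)
      = (\<integral>\<^sup>+s. (\<Sum>k<M. F s * indicator {real k / real M..<(1 + real k) / real M} s) \<partial>lborel)"
    using \<open>M > 0\<close>
    by (simp only: nn_integral_unit_interval[OF assms(1)] sum_distrib_left[symmetric]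
        indicator_consecutive_intervals[OF \<open>M > 0\<close>]) simp
  also have "\<dots> = (\<Sum>k<M. \<integral>\<^sup>+s. F s * indicator {real k / real M..<(1 + real k) / real M} s \<partial>lborel)"
    by (rule nn_integral_sum) auto
  also have "\<dots> = (\<integral>\<^sup>+s. (\<Sum>k<M. F ((s + real k) / real M)) * ennreal (1 / real M) \<partial>unit_interval)"
    by (simp add: piece nn_integral_multc nn_integral_sum sum_distrib_left mult.commute[of _ "ennreal _"]
        nn_integral_cmult)
  finally show ?thesis by simp
qed

lemma riemann_sum_measurable [measurable]:
  assumes [measurable]: "F \<in> borel_measurable borel"
  shows "riemann_sum M F \<in> borel_measurable borel"
  unfolding riemann_sum_def by measurable

lemma riemann_sum_L1_contraction:
  assumes [measurable]: "F \<in> borel_measurable borel"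
  shows "(\<integral>\<^sup>+s. ennreal \<bar>riemann_sum M F s\<bar> \<partial>unit_interval) \<le> (\<integral>\<^sup>+s. ennreal \<bar>F s\<bar> \<partial>unit_interval)"
proof (cases "M = 0")
  case False
  have "ennreal \<bar>riemann_sum M F s\<bar>
      \<le> (\<Sum>k<M. ennreal \<bar>F ((s + real k) / real M)\<bar>) * ennreal (1 / real M)" for s
  proof -
    have "\<bar>riemann_sum M F s\<bar> \<le> (\<Sum>k<M. \<bar>F ((s + real k) / real M)\<bar>) * (1 / real M)"
      unfolding riemann_sum_def by (simp add: divide_right_mono sum_abs)
    then have "ennreal \<bar>riemann_sum M F s\<bar> \<le> ennreal ((\<Sum>k<M. \<bar>F ((s + real k) / real M)\<bar>) * (1 / real M))"
      by (rule ennreal_leI)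
    then show ?thesis by (subst (asm) ennreal_mult) (auto intro: sum_nonneg)
  qed
  then have "(\<integral>\<^sup>+s. ennreal \<bar>riemann_sum M F s\<bar> \<partial>unit_interval)
     \<le> (\<integral>\<^sup>+s. (\<Sum>k<M. ennreal \<bar>F ((s + real k) / real M)\<bar>) * ennreal (1 / real M) \<partial>unit_interval)"
    by (intro nn_integral_mono) auto
  also have "\<dots> = (\<integral>\<^sup>+s. ennreal \<bar>F s\<bar> \<partial>unit_interval)"
    using False by (intro nn_integral_average) auto
  finally show ?thesis .
qed (simp add: riemann_sum_def)

lemma tendsto_0_le_ennreal:
  fixes f g :: "nat \<Rightarrow> ennreal"
  assumes "eventually (\<lambda>n. f n \<le> g n) sequentially" "g \<longlonglongrightarrow> 0"
  shows "f \<longlonglongrightarrow> 0"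
  by (rule tendsto_sandwich[OF always_eventually assms(1) tendsto_const assms(2)]) simp

text \<open>For merely integrable \<open>F\<close> the sums at a given shift \<open>s\<close> need not converge; the mean deviation
over all shifts is the quantity that is stable under \<open>L\<^sup>1\<close>-limits of \<open>F\<close>.\<close>

definition equidistributes :: "(real \<Rightarrow> real) \<Rightarrow> bool" where
  "equidistributes F \<longleftrightarrow>
     (\<lambda>M. \<integral>\<^sup>+s. ennreal \<bar>riemann_sum M F s - (\<integral>t. F t \<partial>unit_interval)\<bar> \<partial>unit_interval) \<longlonglongrightarrow> 0"

lemma riemann_sum_add: "riemann_sum M (\<lambda>x. F x + G x) s = riemann_sum M F s + riemann_sum M G s"
  by (simp add: riemann_sum_def sum.distrib add_divide_distrib)

lemma riemann_sum_cmult: "riemann_sum M (\<lambda>x. c * F x) s = c * riemann_sum M F s"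
  by (simp add: riemann_sum_def sum_distrib_left)

lemma riemann_sum_const: "M > 0 \<Longrightarrow> riemann_sum M (\<lambda>x. c) s = c"
  by (simp add: riemann_sum_def)

lemma equidistributes_add:
  assumes F: "integrable unit_interval F" "equidistributes F"
    and G: "integrable unit_interval G" "equidistributes G"
  shows "equidistributes (\<lambda>x. F x + G x)"
proof -
  have [measurable]: "F \<in> borel_measurable borel" "G \<in> borel_measurable borel"
    using F(1) G(1) by (auto dest: borel_measurable_integrable)
  let ?d = "\<lambda>F M. \<integral>\<^sup>+s. ennreal \<bar>riemann_sum M F s - (\<integral>t. F t \<partial>unit_interval)\<bar> \<partial>unit_interval"
  have "?d (\<lambda>x. F x + G x) M \<le> ?d F M + ?d G M" for M
  proof -
    have "?d (\<lambda>x. F x + G x) M \<le> (\<integral>\<^sup>+s. ennreal \<bar>riemann_sum M F s - (\<integral>t. F t \<partial>unit_interval)\<bar>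
        + ennreal \<bar>riemann_sum M G s - (\<integral>t. G t \<partial>unit_interval)\<bar> \<partial>unit_interval)"
      using F(1) G(1)
      by (intro nn_integral_mono) (auto simp: riemann_sum_add simp flip: ennreal_plus intro!: ennreal_leI)
    also have "\<dots> = ?d F M + ?d G M"
      by (rule nn_integral_add) auto
    finally show ?thesis .
  qed
  moreover have "(\<lambda>M. ?d F M + ?d G M) \<longlonglongrightarrow> 0"
    using tendsto_add[OF F(2)[unfolded equidistributes_def] G(2)[unfolded equidistributes_def]] by simp
  ultimately show ?thesis
    unfolding equidistributes_def
    by (rule tendsto_0_le_ennreal[OF always_eventually[OF allI]])
qed

lemma equidistributes_cmult:
  assumes F: "integrable unit_interval F" "equidistributes F"
  shows "equidistributes (\<lambda>x. c * F x)"
proof -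
  have [measurable]: "F \<in> borel_measurable borel"
    using F(1) by (auto dest: borel_measurable_integrable)
  have "(\<integral>\<^sup>+s. ennreal \<bar>riemann_sum M (\<lambda>x. c * F x) s - (\<integral>t. c * F t \<partial>unit_interval)\<bar> \<partial>unit_interval)
     = ennreal \<bar>c\<bar> * (\<integral>\<^sup>+s. ennreal \<bar>riemann_sum M F s - (\<integral>t. F t \<partial>unit_interval)\<bar> \<partial>unit_interval)" for M
    by (simp add: riemann_sum_cmult ennreal_mult abs_mult nn_integral_cmult flip: right_diff_distrib)
  moreover have "(\<lambda>M. ennreal \<bar>c\<bar> * (\<integral>\<^sup>+s. ennreal \<bar>riemann_sum M F s - (\<integral>t. F t \<partial>unit_interval)\<bar> \<partial>unit_interval))
     \<longlonglongrightarrow> ennreal \<bar>c\<bar> * 0"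
    using F(2) unfolding equidistributes_def by (intro ennreal_tendsto_cmult) auto
  ultimately show ?thesis by (simp add: equidistributes_def)
qed

lemma equidistributes_const: "equidistributes (\<lambda>x. c)"
proof -
  have "(\<integral>\<^sup>+s. ennreal \<bar>riemann_sum M (\<lambda>x. c) s - (\<integral>t. c \<partial>unit_interval)\<bar> \<partial>unit_interval) = 0"
    if "M > 0" for M
    using that by (simp add: riemann_sum_const measure_def)
  then have "eventually (\<lambda>M. (\<integral>\<^sup>+s. ennreal \<bar>riemann_sum M (\<lambda>x. c) s - (\<integral>t. c \<partial>unit_interval)\<bar>
      \<partial>unit_interval) = 0) sequentially"
    by (rule eventually_sequentiallyI[of 1]) auto
  then show ?thesis
    unfolding equidistributes_def by (rule tendsto_eventually)
qed

text \<open>Riemann sums contract the \<open>L\<^sup>1\<close>-norm uniformly in \<open>M\<close>, so replacing \<open>F\<close> by an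
approximation \<open>G\<close> costs at most twice the \<open>L\<^sup>1\<close>-distance.\<close>

lemma equidistributes_L1_limit:
  assumes F: "integrable unit_interval F"
    and G: "\<And>i. integrable unit_interval (G i)" "\<And>i. equidistributes (G i)"
    and lim: "(\<lambda>i. \<integral>\<^sup>+s. ennreal \<bar>F s - G i s\<bar> \<partial>unit_interval) \<longlonglongrightarrow> 0"
  shows "equidistributes F"
proof -
  have [measurable]: "F \<in> borel_measurable borel" "G i \<in> borel_measurable borel" for i
    using F G(1) by (auto dest: borel_measurable_integrable)
  let ?d = "\<lambda>F M. \<integral>\<^sup>+s. ennreal \<bar>riemann_sum M F s - (\<integral>t. F t \<partial>unit_interval)\<bar> \<partial>unit_interval"
  let ?e = "\<lambda>i. \<integral>\<^sup>+s. ennreal \<bar>F s - G i s\<bar> \<partial>unit_interval"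
  have bound: "?d F M \<le> ?d (G i) M + 2 * ?e i" for i M
  proof -
    let ?J = "\<integral>t. F t \<partial>unit_interval" and ?K = "\<integral>t. G i t \<partial>unit_interval"
    have diff: "riemann_sum M F s - riemann_sum M (G i) s = riemann_sum M (\<lambda>x. F x - G i x) s" for s
      using riemann_sum_add[of M F "\<lambda>x. (-1) * G i x" s] riemann_sum_cmult[of M "-1" "G i" s] by simp
    have JK: "ennreal \<bar>?K - ?J\<bar> \<le> ?e i"
    proof -
      have "ennreal \<bar>?K - ?J\<bar> = ennreal (norm (\<integral>t. F t - G i t \<partial>unit_interval))"
        using F G(1)[of i] by (simp add: abs_minus_commute)
      also have "\<dots> \<le> (\<integral>\<^sup>+t. norm (F t - G i t) \<partial>unit_interval)"
        using F G(1)[of i] by (intro integral_norm_bound_ennreal) auto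
      finally show ?thesis by simp
    qed
    have "?d F M \<le> (\<integral>\<^sup>+s. ennreal \<bar>riemann_sum M (G i) s - ?K\<bar>
        + (ennreal \<bar>riemann_sum M (\<lambda>x. F x - G i x) s\<bar> + ennreal \<bar>?K - ?J\<bar>) \<partial>unit_interval)"
      by (intro nn_integral_mono) (auto simp flip: diff ennreal_plus intro!: ennreal_leI)
    also have "\<dots> = ?d (G i) M + ((\<integral>\<^sup>+s. ennreal \<bar>riemann_sum M (\<lambda>x. F x - G i x) s\<bar> \<partial>unit_interval)
        + ennreal \<bar>?K - ?J\<bar>)"
      by (simp add: nn_integral_add)
    also have "\<dots> \<le> ?d (G i) M + (?e i + ?e i)"
      by (intro add_mono order_refl riemann_sum_L1_contraction JK) auto
    finally show ?thesis by (simp add: mult_2)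
  qed
  show ?thesis
    unfolding equidistributes_def
  proof (rule order_tendstoI)
    fix a :: ennreal assume "a > 0"
    have "(\<lambda>i. 2 * ?e i) \<longlonglongrightarrow> 2 * 0"
      using lim by (intro ennreal_tendsto_cmult) auto
    then have "eventually (\<lambda>i. 2 * ?e i < a / 2) sequentially"
      using \<open>a > 0\<close> by (intro order_tendstoD) (auto simp: ennreal_zero_less_divide)
    then obtain i where i: "2 * ?e i < a / 2"
      by (auto simp: eventually_sequentially)
    have "eventually (\<lambda>M. ?d (G i) M < a / 2) sequentially"
      using G(2)[of i] \<open>a > 0\<close> unfolding equidistributes_def
      by (intro order_tendstoD) (auto simp: ennreal_zero_less_divide)
    then show "eventually (\<lambda>M. ?d F M < a) sequentially"
    proof eventually_elim
      case (elim M)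
      have "?d F M \<le> ?d (G i) M + 2 * ?e i" by (rule bound)
      also have "\<dots> < a / 2 + a / 2" using elim i by (rule add_strict_mono)
      also have "a / 2 + a / 2 = a * 2 / 2"
        by (simp only: add_divide_distrib_ennreal mult_2_right)
      also have "\<dots> = a"
        by (rule mult_divide_eq_ennreal) auto
      finally show ?case .
    qed
  qed auto
qed

lemma AE_unit_interval: "AE s in unit_interval. 0 \<le> s \<and> s < 1"
  by (rule AE_uniform_measureI) auto

lemma nn_integral_riemann_sum:
  assumes [measurable]: "F \<in> borel_measurable borel" and "\<And>x. 0 \<le> F x" "M > 0"
  shows "(\<integral>\<^sup>+s. ennreal (riemann_sum M F s) \<partial>unit_interval) = (\<integral>\<^sup>+s. ennreal (F s) \<partial>unit_interval)"
proof -
  have "ennreal (riemann_sum M F s) = (\<Sum>k<M. ennreal (F ((s + real k) / real M))) * ennreal (1 / real M)" for s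
  proof -
    have "riemann_sum M F s = (\<Sum>k<M. F ((s + real k) / real M)) * (1 / real M)"
      by (simp add: riemann_sum_def)
    then show ?thesis using assms(2) by (simp only: ennreal_mult sum_nonneg sum_ennreal of_nat_0_le_iff zero_le_divide_1_iff)
  qed
  then show ?thesis using nn_integral_average[of "\<lambda>x. ennreal (F x)" M] \<open>M > 0\<close> by simp
qed

lemma integral_riemann_sum:
  assumes [measurable]: "F \<in> borel_measurable borel" and "\<And>x. 0 \<le> F x" "M > 0"
  shows "(\<integral>s. riemann_sum M F s \<partial>unit_interval) = (\<integral>s. F s \<partial>unit_interval)"
proof -
  have "0 \<le> riemann_sum M F s" for s
    using assms(2) by (simp add: riemann_sum_def sum_nonneg)
  then show ?thesis
    using assms nn_integral_riemann_sum[of F M] by (simp add: integral_eq_nn_integral)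
qed

text \<open>For decreasing \<open>F\<close> all shifted sums lie between the right and left Riemann sums, whose
difference telescopes to \<open>(F 0 - F 1) / M\<close>. The mean of the shifted sums is the integral, so
each of them is that close to it.\<close>

lemma equidistributes_antimono:
  assumes F: "antimono F" and [measurable]: "F \<in> borel_measurable borel"
    and bounds: "\<And>x. 0 \<le> F x" "\<And>x. F x \<le> B"
  shows "equidistributes F"
proof -
  have close: "\<bar>riemann_sum M F s - (\<integral>t. F t \<partial>unit_interval)\<bar> \<le> B / real M"
    if s: "0 \<le> s" "s < 1" and "M > 0" for s M
  proof -
    have between: "riemann_sum M F 1 \<le> riemann_sum M F t" "riemann_sum M F t \<le> riemann_sum M F 0"
      if "0 \<le> t" "t < 1" for t
      using that \<open>M > 0\<close>
      by (auto simp: riemann_sum_def intro!: divide_right_mono sum_mono antimonoD[OF F])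
    have "riemann_sum M F 0 - riemann_sum M F 1
        = (\<Sum>k<M. F (real k / real M) - F (real (Suc k) / real M)) / real M"
      by (simp add: riemann_sum_def sum_subtractf diff_divide_distrib add.commute)
    also have "\<dots> = (F 0 - F 1) / real M"
      using \<open>M > 0\<close> by (subst sum_lessThan_telescope') simp
    also have "\<dots> \<le> B / real M"
      using bounds(1)[of 1] bounds(2)[of 0] by (intro divide_right_mono) auto
    finally have width: "riemann_sum M F 0 - riemann_sum M F 1 \<le> B / real M" .
    have int: "integrable unit_interval (riemann_sum M F)"
    proof (rule unit_interval.integrable_const_bound)
      show "AE t in unit_interval. norm (riemann_sum M F t) \<le> riemann_sum M F 0"
        using AE_unit_interval
        by eventually_elim (use between bounds(1) in \<open>auto simp: riemann_sum_def sum_nonneg\<close>)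
    qed measurable
    have one: "(\<integral>t. c \<partial>unit_interval) = c" for c :: real
      by (simp add: measure_def)
    have "(\<integral>t. riemann_sum M F 1 \<partial>unit_interval) \<le> (\<integral>t. riemann_sum M F t \<partial>unit_interval)"
    proof (rule integral_mono_AE)
      show "AE t in unit_interval. riemann_sum M F 1 \<le> riemann_sum M F t"
        using AE_unit_interval by eventually_elim (simp add: between)
    qed (use int in simp_all)
    moreover have "(\<integral>t. riemann_sum M F t \<partial>unit_interval) \<le> (\<integral>t. riemann_sum M F 0 \<partial>unit_interval)"
    proof (rule integral_mono_AE)
      show "AE t in unit_interval. riemann_sum M F t \<le> riemann_sum M F 0"
        using AE_unit_interval by eventually_elim (simp add: between)
    qed (use int in simp_all)
    ultimately show ?thesis
      using between[OF s] width \<open>M > 0\<close> unfolding one integral_riemann_sum[OF assms(2) bounds(1) \<open>M > 0\<close>]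
      by linarith
  qed
  have "eventually (\<lambda>M. (\<integral>\<^sup>+s. ennreal \<bar>riemann_sum M F s - (\<integral>t. F t \<partial>unit_interval)\<bar> \<partial>unit_interval)
      \<le> ennreal (B / real M)) sequentially"
  proof (rule eventually_sequentiallyI[of 1])
    fix M :: nat assume "1 \<le> M"
    have "(\<integral>\<^sup>+s. ennreal \<bar>riemann_sum M F s - (\<integral>t. F t \<partial>unit_interval)\<bar> \<partial>unit_interval)
        \<le> (\<integral>\<^sup>+s. ennreal (B / real M) \<partial>unit_interval)"
    proof (rule nn_integral_mono_AE)
      show "AE s in unit_interval. ennreal \<bar>riemann_sum M F s - (\<integral>t. F t \<partial>unit_interval)\<bar>
          \<le> ennreal (B / real M)"
        using AE_unit_interval by eventually_elim (use \<open>1 \<le> M\<close> in \<open>auto intro!: ennreal_leI close\<close>)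
    qed
    then show "(\<integral>\<^sup>+s. ennreal \<bar>riemann_sum M F s - (\<integral>t. F t \<partial>unit_interval)\<bar> \<partial>unit_interval)
        \<le> ennreal (B / real M)" by simp
  qed
  moreover have "(\<lambda>M. ennreal (B / real M)) \<longlonglongrightarrow> ennreal 0"
    by (intro tendsto_ennrealI tendsto_divide_0[OF tendsto_const] filterlim_at_top_imp_at_infinity
        filterlim_real_sequentially)
  ultimately show ?thesis
    unfolding equidistributes_def ennreal_0 by (rule tendsto_0_le_ennreal)
qed

text \<open>Half-lines have decreasing indicators; the Borel sets that equidistribute form a Dynkin
system, and half-lines are closed under intersection.\<close>

lemma equidistributes_indicator:
  assumes "A \<in> sets borel"
  shows "equidistributes (indicator A)"
proof -
  have A: "A \<in> sigma_sets UNIV (range lessThan)"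
    using assms by (simp add: borel_Iio)
  have borel: "B \<in> sets borel" if "B \<in> sigma_sets UNIV (range lessThan)" for B :: "real set"
    using that by (simp add: borel_Iio)
  have int: "integrable unit_interval (indicator B :: real \<Rightarrow> real)" if "B \<in> sets borel" for B
    using that by (intro unit_interval.integrable_const_bound[where B = 1]) (auto simp: indicator_def)
  have "Int_stable (range lessThan :: real set set)"
  proof -
    have "{..<a} \<inter> {..<b} = {..<min a b}" for a b :: real by auto
    then show ?thesis by (auto simp: Int_stable_def)
  qed
  from this subset_UNIV[of "range lessThan", folded Pow_UNIV] A show ?thesis
  proof (induction rule: sigma_sets_induct_disjoint)
    case (basic B)
    then show ?case
      by (intro equidistributes_antimono[where B = 1])
         (auto simp: antimono_def indicator_def split: if_splits)
  next
    case empty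
    then show ?case using equidistributes_const[of 0] by simp
  next
    case (compl B)
    have "equidistributes (\<lambda>x. 1 + (-1) * indicator B x)"
      using compl int[OF borel] by (intro equidistributes_add equidistributes_cmult equidistributes_const) auto
    then show ?case
      by (rule back_subst[of equidistributes]) (auto simp: indicator_def fun_eq_iff)
  next
    case (union B)
    have [measurable]: "B i \<in> sets borel" for i using union borel by auto
    let ?G = "\<lambda>n x. \<Sum>i<n. indicator (B i) x :: real"
    have G: "equidistributes (?G n)" for n
    proof (induction n)
      case 0 then show ?case using equidistributes_const[of 0] by simp
    next
      case (Suc n)
      have "equidistributes (\<lambda>x. ?G n x + indicator (B n) x)"
        using Suc union(3)[of n] int by (intro equidistributes_add) auto
      then show ?case by simp
    qed
    have sums: "?G n x = indicator (\<Union>i<n. B i) x" for n x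
      using union(1) by (intro indicator_UN_disjoint[symmetric]) (auto simp: disjoint_family_on_def)
    have "(\<lambda>n. \<integral>\<^sup>+s. ennreal \<bar>indicator (\<Union>i. B i) s - ?G n s\<bar> \<partial>unit_interval)
        \<longlonglongrightarrow> (\<integral>\<^sup>+s. 0 \<partial>unit_interval)"
    proof (rule nn_integral_dominated_convergence[where w = "\<lambda>_. 1"])
      show "AE s in unit_interval. (\<lambda>n. ennreal \<bar>indicator (\<Union>i. B i) s - ?G n s\<bar>) \<longlonglongrightarrow> 0"
      proof (rule AE_I2)
        fix s
        have "eventually (\<lambda>n. ?G n s = indicator (\<Union>i. B i) s) sequentially"
        proof (cases "\<exists>i. s \<in> B i")
          case True
          then obtain i where "s \<in> B i" by blast
          then show ?thesis
            unfolding sums by (intro eventually_sequentiallyI[of "Suc i"]) (auto simp: indicator_def)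
        qed (auto simp: sums indicator_def)
        then have "eventually (\<lambda>n. ennreal \<bar>indicator (\<Union>i. B i) s - ?G n s\<bar> = 0) sequentially"
          by eventually_elim simp
        then show "(\<lambda>n. ennreal \<bar>indicator (\<Union>i. B i) s - ?G n s\<bar>) \<longlonglongrightarrow> 0"
          by (rule tendsto_eventually)
      qed
    next
      show "AE s in unit_interval. ennreal \<bar>indicator (\<Union>i. B i) s - ?G n s\<bar> \<le> 1" for n
        unfolding sums by (rule AE_I2) (auto simp: indicator_def)
    qed (auto simp: less_top)
    then have lim: "(\<lambda>n. \<integral>\<^sup>+s. ennreal \<bar>indicator (\<Union>i. B i) s - ?G n s\<bar> \<partial>unit_interval) \<longlonglongrightarrow> 0"
      by simp
    have "integrable unit_interval (indicator (\<Union>i. B i) :: real \<Rightarrow> real)"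
      "integrable unit_interval (?G n)" for n
      by (auto intro!: int Bochner_Integration.integrable_sum)
    then show ?case
      by (rule equidistributes_L1_limit[OF _ _ G lim])
  qed
qed

theorem equidistributes_integrable:
  assumes "integrable unit_interval F"
  shows "equidistributes F"
  using assms
proof (induction rule: integrable_induct)
  case (base A c)
  then have "equidistributes (\<lambda>x. c * indicator A x)"
    by (intro equidistributes_cmult equidistributes_indicator) auto
  then show ?case by (simp add: mult.commute)
next
  case (add f g)
  then show ?case by (intro equidistributes_add)
next
  case (lim f s)
  have [measurable]: "f \<in> borel_measurable borel" "s i \<in> borel_measurable borel" for i
    using lim by (auto dest: borel_measurable_integrable)
  have "(\<lambda>i. \<integral>\<^sup>+x. ennreal \<bar>f x - s i x\<bar> \<partial>unit_interval) \<longlonglongrightarrow> (\<integral>\<^sup>+x. 0 \<partial>unit_interval)"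
  proof (rule nn_integral_dominated_convergence[where w = "\<lambda>x. ennreal (3 * \<bar>f x\<bar>)"])
    show "AE x in unit_interval. ennreal \<bar>f x - s i x\<bar> \<le> ennreal (3 * \<bar>f x\<bar>)" for i
      using lim(3)[of _ i] by (intro AE_I2 ennreal_leI) (smt (verit) real_norm_def)
    have "(\<integral>\<^sup>+x. ennreal (3 * \<bar>f x\<bar>) \<partial>unit_interval) = ennreal (\<integral>x. 3 * \<bar>f x\<bar> \<partial>unit_interval)"
      using lim(4) by (intro nn_integral_eq_integral) auto
    then show "(\<integral>\<^sup>+x. ennreal (3 * \<bar>f x\<bar>) \<partial>unit_interval) < \<infinity>" by simp
    show "AE x in unit_interval. (\<lambda>i. ennreal \<bar>f x - s i x\<bar>) \<longlonglongrightarrow> 0"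
    proof (rule AE_I2)
      fix x assume "x \<in> space unit_interval"
      then have "(\<lambda>i. \<bar>f x - s i x\<bar>) \<longlonglongrightarrow> \<bar>f x - f x\<bar>"
        by (intro tendsto_intros lim(2))
      then show "(\<lambda>i. ennreal \<bar>f x - s i x\<bar>) \<longlonglongrightarrow> 0"
        using tendsto_ennrealI by fastforce
    qed
  qed auto
  then have "(\<lambda>i. \<integral>\<^sup>+x. ennreal \<bar>f x - s i x\<bar> \<partial>unit_interval) \<longlonglongrightarrow> 0"
    by simp
  then show ?case
    by (rule equidistributes_L1_limit[OF lim.hyps(4) lim.hyps(1) lim.IH])
qed

section \<open>The transfer operator of the power map\<close>

lemma space_circle_measure [simp]: "space circle_measure = sphere 0 1"
  by (simp add: circle_measure_def)

lemma sets_circle_measure [measurable_cong]: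
  "sets circle_measure = sets (restrict_space borel (sphere 0 1))"
  by (simp add: circle_measure_def)

lemma measurable_cis_circle [measurable]:
  "(\<lambda>t. cis (2 * pi * t)) \<in> borel \<rightarrow>\<^sub>M restrict_space borel (sphere 0 1)"
  by (intro measurable_restrict_space2 borel_measurable_continuous_onI)
     (auto intro!: continuous_intros)

lemma measurable_power_circle [measurable]:
  "(\<lambda>z. z ^ M) \<in> circle_measure \<rightarrow>\<^sub>M circle_measure"
proof -
  have "(\<lambda>z::complex. z ^ M) \<in> restrict_space borel (sphere 0 1) \<rightarrow>\<^sub>M restrict_space borel (sphere 0 1)"
    by (intro measurable_restrict_space3) (auto simp: norm_power)
  then show ?thesis
    by (simp add: measurable_cong_sets[OF sets_circle_measure sets_circle_measure])
qed

lemma nn_integral_circle_measure: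
  assumes [measurable]: "f \<in> borel_measurable circle_measure"
  shows "(\<integral>\<^sup>+z. f z \<partial>circle_measure) = (\<integral>\<^sup>+t. f (cis (2 * pi * t)) \<partial>unit_interval)"
  using assms unfolding circle_measure_def by (intro nn_integral_distr) simp_all

lemma measurable_comp_cis [measurable]:
  assumes "f \<in> borel_measurable circle_measure"
  shows "(\<lambda>t. f (cis (2 * pi * t))) \<in> borel_measurable borel"
  using assms by measurable

lemma integrable_circle_measure:
  fixes f :: "complex \<Rightarrow> real"
  assumes "integrable circle_measure f"
  shows "integrable unit_interval (\<lambda>t. f (cis (2 * pi * t)))"
proof -
  have "f \<in> borel_measurable (restrict_space borel (sphere 0 1))"
    using borel_measurable_integrable[OF assms] by (simp add: measurable_cong_sets[OF sets_circle_measure refl])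
  then show ?thesis
    using assms unfolding circle_measure_def by (subst (asm) integrable_distr_eq) simp_all
qed

lemma integral_circle_measure:
  fixes f :: "complex \<Rightarrow> real"
  assumes "f \<in> borel_measurable circle_measure"
  shows "(\<integral>z. f z \<partial>circle_measure) = (\<integral>t. f (cis (2 * pi * t)) \<partial>unit_interval)"
  using assms unfolding circle_measure_def by (intro integral_distr) simp_all

lemma emeasure_circle_measure: "emeasure circle_measure (sphere 0 1) = 1"
  using nn_integral_circle_measure[of "\<lambda>_. 1"] by simp

interpretation circle_measure: finite_measure circle_measure
  by (rule finite_measureI) (simp add: emeasure_circle_measure)

text \<open>The transfer operator of \<open>z \<mapsto> z ^ M\<close> with respect to Haar measure, that is, the Ruelle
operator of the constant filter \<open>1\<close>.\<close>

definition transfer :: "nat \<Rightarrow> (complex \<Rightarrow> real) \<Rightarrow> complex \<Rightarrow> real" where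
  "transfer M f z = (\<Sum>w | w ^ M = z. f w) / real M"

lemma ruelle_eq_transfer: "ruelle N m0 h = transfer N (\<lambda>w. (cmod (m0 w))\<^sup>2 * h w)"
  by (auto simp: ruelle_def transfer_def fun_eq_iff)

lemma sum_roots_eq:
  fixes f :: "complex \<Rightarrow> 'a::comm_monoid_add"
  assumes "M > 0" "w0 \<noteq> 0"
  shows "(\<Sum>w | w ^ M = w0 ^ M. f w) = (\<Sum>k<M. f (w0 * cis (2 * pi * real k / real M)))"
proof -
  have "bij_betw ((*) w0) {z. z ^ M = 1} {w. w ^ M = w0 ^ M}"
    using assms by (intro bij_betwI[where g = "\<lambda>w. w / w0"]) (auto simp: power_mult_distrib power_divide)
  from bij_betw_trans[OF Complex.bij_betw_roots_unity[OF assms(1)] this]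
  show ?thesis by (subst sum.reindex_bij_betw[symmetric]) (auto simp: o_def)
qed

text \<open>In the angular coordinate the \<open>M\<close>-th roots of \<open>z\<close> are equally spaced, so root averages are
shifted Riemann sums.\<close>

lemma transfer_cis:
  assumes "M > 0"
  shows "transfer M f (cis (2 * pi * s)) = riemann_sum M (\<lambda>t. f (cis (2 * pi * t))) s"
proof -
  have "cis (2 * pi * s) = cis (2 * pi * s / real M) ^ M"
    using assms by (simp add: Complex.DeMoivre)
  then have "(\<Sum>w | w ^ M = cis (2 * pi * s). f w)
      = (\<Sum>k<M. f (cis (2 * pi * s / real M) * cis (2 * pi * real k / real M)))"
    using sum_roots_eq[OF assms, of "cis (2 * pi * s / real M)" f] by simp
  also have "\<dots> = (\<Sum>k<M. f (cis (2 * pi * ((s + real k) / real M))))"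
    by (intro sum.cong refl) (simp add: cis_mult add_divide_distrib ring_distribs)
  finally show ?thesis by (simp add: transfer_def riemann_sum_def)
qed

text \<open>The principal branch of the \<open>M\<close>-th root is Borel, and the other roots are its rotations.\<close>

lemma transfer_measurable [measurable]:
  assumes [measurable]: "f \<in> borel_measurable circle_measure"
  shows "transfer M f \<in> borel_measurable circle_measure"
proof (cases "M = 0")
  case False
  let ?r = "\<lambda>z. exp (Ln z / of_nat M)"
  have rot: "(\<lambda>z. ?r z * cis (2 * pi * real k / real M)) \<in> circle_measure \<rightarrow>\<^sub>M circle_measure" for k
  proof -
    have "(\<lambda>z. ?r z * cis (2 * pi * real k / real M))
        \<in> restrict_space borel (sphere 0 1) \<rightarrow>\<^sub>M restrict_space borel (sphere 0 1)"
    proof (intro measurable_restrict_space3)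
      show "(\<lambda>z. ?r z * cis (2 * pi * real k / real M)) \<in> sphere 0 1 \<rightarrow> sphere 0 1"
      proof
        fix z :: complex assume "z \<in> sphere 0 1"
        then have "z \<noteq> 0" "cmod z = 1" by auto
        then show "?r z * cis (2 * pi * real k / real M) \<in> sphere 0 1"
          by (simp add: norm_mult Re_divide_of_nat Re_Ln)
      qed
    qed measurable
    then show ?thesis
      by (simp add: measurable_cong_sets[OF sets_circle_measure sets_circle_measure])
  qed
  have [measurable]: "(\<lambda>z. f (?r z * cis (2 * pi * real k / real M))) \<in> borel_measurable circle_measure" for k
    by (rule measurable_compose[OF rot assms])
  have "(\<lambda>z. (\<Sum>k<M. f (?r z * cis (2 * pi * real k / real M))) / real M) \<in> borel_measurable circle_measure"
    by measurable
  moreover have "transfer M f z = (\<Sum>k<M. f (?r z * cis (2 * pi * real k / real M))) / real M"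
    if "z \<in> space circle_measure" for z
  proof -
    have "z \<noteq> 0" using that by auto
    then have "?r z ^ M = z"
      using False by (subst exp_of_nat_mult[symmetric]) simp
    then show ?thesis
      using sum_roots_eq[of M "?r z" f] False by (simp add: transfer_def)
  qed
  ultimately show ?thesis by (subst measurable_cong) auto
qed (simp add: transfer_def[abs_def])

lemma nn_integral_transfer:
  assumes f [measurable]: "f \<in> borel_measurable circle_measure" and "\<And>z. 0 \<le> f z" "M > 0"
  shows "(\<integral>\<^sup>+z. ennreal (transfer M f z) \<partial>circle_measure) = (\<integral>\<^sup>+z. ennreal (f z) \<partial>circle_measure)"
  using assms(2,3)
  by (simp add: nn_integral_circle_measure transfer_cis nn_integral_riemann_sum[OF measurable_comp_cis])

lemma transfer_equidistributes:
  assumes f: "integrable circle_measure f"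
  shows "(\<lambda>M. \<integral>\<^sup>+z. ennreal \<bar>transfer M f z - (\<integral>w. f w \<partial>circle_measure)\<bar> \<partial>circle_measure) \<longlonglongrightarrow> 0"
proof (rule tendsto_0_le_ennreal)
  have [measurable]: "f \<in> borel_measurable circle_measure"
    using f by auto
  let ?F = "\<lambda>t. f (cis (2 * pi * t))"
  show "(\<lambda>M. \<integral>\<^sup>+s. ennreal \<bar>riemann_sum M ?F s - (\<integral>t. ?F t \<partial>unit_interval)\<bar> \<partial>unit_interval) \<longlonglongrightarrow> 0"
    using equidistributes_integrable[OF integrable_circle_measure[OF f]] by (simp add: equidistributes_def)
  show "\<forall>\<^sub>F M in sequentially. (\<integral>\<^sup>+z. ennreal \<bar>transfer M f z - (\<integral>w. f w \<partial>circle_measure)\<bar> \<partial>circle_measure)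
     \<le> (\<integral>\<^sup>+s. ennreal \<bar>riemann_sum M ?F s - (\<integral>t. ?F t \<partial>unit_interval)\<bar> \<partial>unit_interval)"
    by (rule eventually_sequentiallyI[of 1])
       (simp add: nn_integral_circle_measure transfer_cis integral_circle_measure)
qed

text \<open>On the roots of \<open>z\<close> the factor \<open>g (w ^ M)\<close> is the constant \<open>g z\<close>.\<close>

lemma transfer_mult_power: "transfer M (\<lambda>w. f w * g (w ^ M)) z = transfer M f z * g z"
  by (simp add: transfer_def sum_distrib_right)

lemma transfer_one: "M > 0 \<Longrightarrow> z \<noteq> 0 \<Longrightarrow> transfer M (\<lambda>w. 1) z = 1"
  by (simp add: transfer_def card_nth_roots)

lemma transfer_cong: "(\<And>w. w ^ M = z \<Longrightarrow> f w = g w) \<Longrightarrow> transfer M f z = transfer M g z"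
  by (simp add: transfer_def)

lemma transfer_mono: "(\<And>w. w ^ M = z \<Longrightarrow> f w \<le> g w) \<Longrightarrow> transfer M f z \<le> transfer M g z"
  by (auto simp: transfer_def intro!: divide_right_mono sum_mono)

text \<open>An \<open>(M * N)\<close>-th root of \<open>z\<close> is an \<open>M\<close>-th root of an \<open>N\<close>-th root of \<open>z\<close>.\<close>

lemma transfer_transfer:
  assumes "M > 0" "N > 0"
  shows "transfer N (transfer M f) z = transfer (M * N) f z"
proof -
  have fin: "finite {w::complex. w ^ k = c}" if "k > 0" for k c
    using that by (rule finite_nth_roots)
  have "(\<Sum>v | v ^ N = z. \<Sum>w | w ^ M = v. f w)
      = (\<Sum>v | v ^ N = z. \<Sum>w | w \<in> {w. w ^ (M * N) = z} \<and> w ^ M = v. f w)"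
    by (intro sum.cong) (auto simp: power_mult)
  also have "\<dots> = (\<Sum>w | w ^ (M * N) = z. f w)"
    using assms by (intro sum.group fin) (auto simp: power_mult)
  finally show ?thesis
    by (simp add: transfer_def flip: sum_divide_distrib)
qed

text \<open>The indicator \<open>1\<^sub>A\<close> of a null set has a transfer of integral \<open>0\<close>; since the terms are
nonnegative, almost every point has no root in \<open>A\<close>.\<close>

lemma AE_all_roots:
  assumes "AE z in circle_measure. P z" "M > 0"
  shows "AE z in circle_measure. \<forall>w. w ^ M = z \<longrightarrow> P w"
proof -
  obtain A where A [measurable]: "A \<in> sets circle_measure" "emeasure circle_measure A = 0"
    "{z \<in> sphere 0 1. \<not> P z} \<subseteq> A"
    using assms(1) by (auto elim: AE_E)
  have "(\<integral>\<^sup>+z. ennreal (transfer M (indicator A) z) \<partial>circle_measure) = 0"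
    using A assms(2) by (subst nn_integral_transfer) (auto simp: ennreal_indicator)
  then have "AE z in circle_measure. transfer M (indicator A) z \<le> 0"
    by (subst (asm) nn_integral_0_iff_AE) (auto simp: ennreal_eq_0_iff)
  with AE_space show ?thesis
  proof eventually_elim
    case (elim z)
    have "finite {w. w ^ M = z}" using assms(2) by (rule finite_nth_roots)
    moreover have "(\<Sum>w | w ^ M = z. indicat_real A w) \<le> 0"
      using elim assms(2) by (simp add: transfer_def divide_le_0_iff)
    moreover have "0 \<le> (\<Sum>w | w ^ M = z. indicat_real A w)"
      by (rule sum_nonneg) simp
    ultimately have "\<forall>w\<in>{w. w ^ M = z}. indicat_real A w = 0"
      by (subst sum_nonneg_eq_0_iff[symmetric]) auto
    then have "indicat_real A w = 0" if "w ^ M = z" for w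
      using that by simp
    moreover have "cmod w = 1" if "w ^ M = z" for w
    proof -
      have "cmod w ^ M = 1" using elim that by (auto simp flip: norm_power)
      then show ?thesis using assms(2) using power_eq_imp_eq_base[of "cmod w" M 1] assms(2) by simp
    qed
    ultimately show ?case using A(3) by (auto simp: indicator_def split: if_splits)
  qed
qed

text \<open>The power map preserves Haar measure: transferring \<open>g (w ^ M)\<close> gives back \<open>g\<close>, and the
transfer operator preserves integrals.\<close>

lemma AE_power:
  assumes "AE z in circle_measure. P z" "M > 0"
  shows "AE z in circle_measure. P (z ^ M)"
proof -
  obtain A where A [measurable]: "A \<in> sets circle_measure" "emeasure circle_measure A = 0"
    "{z \<in> sphere 0 1. \<not> P z} \<subseteq> A"
    using assms(1) by (auto elim: AE_E)
  have meas: "(\<lambda>w. indicat_real A (w ^ M)) \<in> borel_measurable circle_measure"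
    by measurable
  have "(\<integral>\<^sup>+z. ennreal (indicator A (z ^ M)) \<partial>circle_measure)
      = (\<integral>\<^sup>+z. ennreal (transfer M (\<lambda>w. indicator A (w ^ M)) z) \<partial>circle_measure)"
    using assms(2) meas by (subst nn_integral_transfer) auto
  also have "\<dots> = (\<integral>\<^sup>+z. ennreal (indicator A z) \<partial>circle_measure)"
  proof (rule nn_integral_cong)
    fix z assume "z \<in> space circle_measure"
    then have "z \<noteq> 0" by auto
    then show "ennreal (transfer M (\<lambda>w. indicator A (w ^ M)) z) = ennreal (indicator A z)"
      using transfer_mult_power[of M "\<lambda>_. 1" "indicator A" z] transfer_one[OF assms(2)] by simp
  qed
  also have "\<dots> = 0" using A by (simp add: ennreal_indicator)
  finally have "AE z in circle_measure. indicat_real A (z ^ M) \<le> 0"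
    using meas by (subst (asm) nn_integral_0_iff_AE) (auto simp: ennreal_eq_0_iff)
  with AE_space show ?thesis
  proof eventually_elim
    case (elim z)
    then have "z ^ M \<in> sphere 0 1" "z ^ M \<notin> A"
      by (auto simp: norm_power indicator_def split: if_splits)
    then show ?case using A(3) by blast
  qed
qed

lemma transfer_iterate_equidistributes:
  assumes "integrable circle_measure f" "N \<ge> 2"
  shows "(\<lambda>n. \<integral>\<^sup>+z. ennreal \<bar>transfer (N ^ n) f z - (\<integral>w. f w \<partial>circle_measure)\<bar> \<partial>circle_measure) \<longlonglongrightarrow> 0"
proof -
  have "strict_mono (\<lambda>n. N ^ n)"
    using assms(2) by (intro strict_monoI power_strict_increasing) auto
  from LIMSEQ_subseq_LIMSEQ[OF transfer_equidistributes[OF assms(1)] this]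
  show ?thesis by (simp add: o_def)
qed

lemma AE_circle_measure_ex:
  assumes "AE z in circle_measure. P z"
  shows "\<exists>z. P z"
proof (rule ccontr)
  assume "\<nexists>z. P z"
  then have "AE z in circle_measure. False" using assms by simp
  then have "emeasure circle_measure (space circle_measure) = 0"
    using sets.top[of circle_measure] by (subst (asm) AE_iff_measurable[of "sphere 0 1"]) auto
  then show False by (simp add: emeasure_circle_measure)
qed

text \<open>A fixed point equals all its iterates, which tend to its mean.\<close>

lemma AE_eq_const_if_transfer_fixed:
  assumes f: "integrable circle_measure f" and "N \<ge> 2"
    and fixed: "AE z in circle_measure. transfer N f z = f z"
  shows "AE z in circle_measure. f z = (\<integral>w. f w \<partial>circle_measure)"
proof -
  let ?I = "\<integral>w. f w \<partial>circle_measure"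
  have [measurable]: "f \<in> borel_measurable circle_measure" using f by auto
  have iterate: "AE z in circle_measure. transfer (N ^ n) f z = f z" for n
  proof (induction n)
    case 0
    show ?case by (simp add: transfer_def)
  next
    case (Suc n)
    have "N > 0" using \<open>N \<ge> 2\<close> by simp
    from AE_all_roots[OF Suc this] fixed show ?case
    proof eventually_elim
      case (elim z)
      have "transfer (N ^ Suc n) f z = transfer N (transfer (N ^ n) f) z"
        using \<open>N \<ge> 2\<close> by (simp add: transfer_transfer mult.commute)
      also have "\<dots> = transfer N f z"
        using elim(1) by (intro transfer_cong) auto
      finally show ?case using elim(2) by simp
    qed
  qed
  have "(\<integral>\<^sup>+z. ennreal \<bar>transfer (N ^ n) f z - ?I\<bar> \<partial>circle_measure)
      = (\<integral>\<^sup>+z. ennreal \<bar>f z - ?I\<bar> \<partial>circle_measure)" for n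
    using iterate[of n] by (intro nn_integral_cong_AE) auto
  then have "(\<integral>\<^sup>+z. ennreal \<bar>f z - ?I\<bar> \<partial>circle_measure) = 0"
    using transfer_iterate_equidistributes[OF f \<open>N \<ge> 2\<close>] by (simp add: LIMSEQ_const_iff)
  then show ?thesis
    by (subst (asm) nn_integral_0_iff_AE) auto
qed

lemma integral_transfer:
  assumes "f \<in> borel_measurable circle_measure" and "\<And>z. 0 \<le> f z" "M > 0"
  shows "(\<integral>z. transfer M f z \<partial>circle_measure) = (\<integral>z. f z \<partial>circle_measure)"
proof -
  have "0 \<le> transfer M f z" for z
    using assms(2) by (simp add: transfer_def sum_nonneg)
  then show ?thesis
    using assms nn_integral_transfer[of f M] by (simp add: integral_eq_nn_integral)
qed

text \<open>A nonnegative fixed point \<open>k\<close> need not be integrable, but its truncations \<open>u = min k L\<close> are.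
Averaging does not increase a minimum of \<open>k\<close> and a constant, so the transfer of \<open>u\<close> is at most
\<open>u\<close>; both have the same integral, hence they agree.\<close>

lemma AE_eq_const_if_transfer_fixed_nonneg:
  assumes [measurable]: "k \<in> borel_measurable circle_measure" and "\<And>z. 0 \<le> k z" and "N \<ge> 2"
    and fixed: "AE z in circle_measure. transfer N k z = k z"
  obtains \<kappa> where "AE z in circle_measure. k z = \<kappa>"
proof -
  have N: "N > 0" using \<open>N \<ge> 2\<close> by simp
  let ?u = "\<lambda>L z. min (k z) (real L)"
  have [measurable]: "?u L \<in> borel_measurable circle_measure" for L by measurable
  have nonneg: "0 \<le> ?u L z" for L z using assms(2) by simp
  have bound: "0 \<le> transfer N (?u L) z \<and> transfer N (?u L) z \<le> real L \<and> transfer N (?u L) z \<le> transfer N k z"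
    if "z \<in> sphere 0 1" for L z
  proof -
    have "z \<noteq> 0" using that by auto
    have "transfer N (?u L) z \<le> transfer N (\<lambda>w. 1 * real L) z"
      by (rule transfer_mono) simp
    also have "\<dots> = real L"
      using transfer_mult_power[of N "\<lambda>w. 1" "\<lambda>_. real L" z] transfer_one[OF N \<open>z \<noteq> 0\<close>] by simp
    finally have "transfer N (?u L) z \<le> real L" .
    moreover have "transfer N (?u L) z \<le> transfer N k z"
      by (rule transfer_mono) simp
    ultimately show ?thesis
      using nonneg[of _ L] by (simp add: transfer_def sum_nonneg)
  qed
  have const: "AE z in circle_measure. ?u L z = (\<integral>w. ?u L w \<partial>circle_measure)" for L
  proof (rule AE_eq_const_if_transfer_fixed[OF _ \<open>N \<ge> 2\<close>])
    show int: "integrable circle_measure (?u L)"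
      using nonneg by (intro circle_measure.integrable_const_bound[where B = "real L"]) auto
    have int': "integrable circle_measure (transfer N (?u L))"
      using bound by (intro circle_measure.integrable_const_bound[where B = "real L"]) auto
    have le: "AE z in circle_measure. transfer N (?u L) z \<le> ?u L z"
      using fixed AE_space
    proof eventually_elim
      case (elim z)
      then show ?case using bound[of z L] by simp
    qed
    have "(\<integral>z. ?u L z - transfer N (?u L) z \<partial>circle_measure) = 0"
      using int int' integral_transfer[of "?u L", OF _ nonneg N] by simp
    then have "AE z in circle_measure. ?u L z - transfer N (?u L) z = 0"
      using int int' le by (subst (asm) integral_nonneg_eq_0_iff_AE) auto
    then show "AE z in circle_measure. transfer N (?u L) z = ?u L z"
      by eventually_elim simp
  qed
  then have all: "AE z in circle_measure. \<forall>L. ?u L z = (\<integral>w. ?u L w \<partial>circle_measure)"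
    by (simp add: AE_all_countable)
  from AE_circle_measure_ex[OF this] obtain z0
    where z0: "\<And>L. ?u L z0 = (\<integral>w. ?u L w \<partial>circle_measure)" by blast
  have "AE z in circle_measure. k z = k z0"
    using all
  proof eventually_elim
    case (elim z)
    obtain L where "max (k z) (k z0) \<le> real L" using real_arch_simple by blast
    moreover have "?u L z = ?u L z0" using elim z0 by simp
    ultimately show ?case by simp
  qed
  then show ?thesis by (rule that)
qed

lemma not_AE_outside_ball:
  assumes "\<delta> > 0"
  shows "\<not> (AE z in circle_measure. \<not> dist z 1 < \<delta>)"
proof
  assume "AE z in circle_measure. \<not> dist z 1 < \<delta>"
  then have ae: "AE t in unit_interval. \<not> dist (cis (2 * pi * t)) 1 < \<delta>"
    unfolding circle_measure_def by (rule AE_distrD[rotated]) measurable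
  have "continuous_on UNIV (\<lambda>t. cis (2 * pi * t))"
    by (intro continuous_intros)
  then have "isCont (\<lambda>t. cis (2 * pi * t)) 0"
    by (simp add: continuous_on_eq_continuous_at)
  then obtain \<eta> where \<eta>: "\<eta> > 0" "\<And>t. dist t 0 < \<eta> \<Longrightarrow> dist (cis (2 * pi * t)) (cis (2 * pi * 0)) < \<delta>"
    using assms unfolding continuous_at_eps_delta by blast
  have "AE t in unit_interval. t \<notin> {0..<min \<eta> 1}"
    using ae by eventually_elim (use \<eta>(2) in \<open>auto simp: dist_real_def\<close>)
  then have "emeasure unit_interval {0..<min \<eta> 1} = 0"
    by (subst (asm) AE_iff_measurable[of "{0..<min \<eta> 1}"]) auto
  then have "ennreal (min \<eta> 1) = 0"
    using \<eta>(1) by (simp add: Int_absorb1 divide_ennreal_def)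
  then show False using \<eta>(1) by simp
qed

section \<open>Backward orbits in the weighted space\<close>

locale harmonic_filter =
  fixes N :: nat and m0 :: "complex \<Rightarrow> complex" and h :: "complex \<Rightarrow> real"
  assumes N_ge_2: "N \<ge> 2"
    and wavelet_filter: "wavelet_filter N m0"
    and h_integrable: "integrable circle_measure h"
    and h_nonneg: "AE z in circle_measure. h z \<ge> 0"
    and harmonic: "AE z in circle_measure. ruelle N m0 h z = h z"
begin

lemma N_pos: "N > 0" using N_ge_2 by simp

lemma m0_measurable [measurable]: "m0 \<in> borel_measurable circle_measure"
  using wavelet_filter by (simp add: wavelet_filter_def Linf_def)

lemma h_measurable [measurable]: "h \<in> borel_measurable circle_measure"
  using h_integrable by auto

lemma AE_transfer_filter: "AE z in circle_measure. transfer N (\<lambda>w. (cmod (m0 w))\<^sup>2) (z ^ N) = 1"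
proof -
  have "AE z in circle_measure.
      (\<Sum>k<N. (cmod (m0 (exp (\<i> * of_real (2 * pi * real k / real N)) * z)))\<^sup>2) = real N"
    using wavelet_filter by (simp add: wavelet_filter_def)
  with AE_space show ?thesis
  proof eventually_elim
    case (elim z)
    then have "z \<noteq> 0" by auto
    then have "(\<Sum>w | w ^ N = z ^ N. (cmod (m0 w))\<^sup>2)
        = (\<Sum>k<N. (cmod (m0 (exp (\<i> * of_real (2 * pi * real k / real N)) * z)))\<^sup>2)"
      by (subst sum_roots_eq[OF N_pos]) (simp_all add: cis_conv_exp mult.commute)
    then show ?case using elim(2) N_pos by (simp add: transfer_def)
  qed
qed

lemma AE_from_power:
  assumes "AE z in circle_measure. P (z ^ N)"
  shows "AE z in circle_measure. P z"
  using AE_all_roots[OF assms N_pos] AE_space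
proof eventually_elim
  case (elim z)
  then have "z \<noteq> 0" by auto
  then have "card {w. w ^ N = z} > 0"
    using N_pos by (simp add: card_nth_roots)
  then obtain w where "w ^ N = z"
    by (auto simp: card_gt_0_iff)
  then show ?case using elim by auto
qed

text \<open>The relation \<open>h (z ^ N) = \<bar>m\<^sub>0 z\<bar>\<^sup>2 h z\<close> says that \<open>1/h\<close> at a root \<open>w\<close> of \<open>z\<close> is
\<open>\<bar>m\<^sub>0 w\<bar>\<^sup>2 / h z\<close>. Averaging over the roots and using the filter identity, \<open>1/h\<close> is fixed by the
transfer operator, hence constant. Then \<open>\<bar>m\<^sub>0\<bar> = 1\<close> almost everywhere, whereas \<open>\<bar>m\<^sub>0\<bar> > 1\<close> on an
arc around \<open>1\<close>.\<close>

lemma no_coboundary: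
  assumes pos: "AE z in circle_measure. h z > 0"
    and cob: "AE z in circle_measure. h (z ^ N) = (cmod (m0 z))\<^sup>2 * h z"
  shows False
proof -
  \<comment> \<open>The absolute value changes \<open>h\<close> only on a null set and makes \<open>1/h\<close> nonnegative everywhere.\<close>
  let ?k = "\<lambda>z. inverse \<bar>h z\<bar>"
  have "AE z in circle_measure. h z > 0 \<and> h (z ^ N) > 0 \<and> h (z ^ N) = (cmod (m0 z))\<^sup>2 * h z"
    using pos cob AE_power[OF pos N_pos] by eventually_elim simp
  from AE_power[OF AE_all_roots[OF this N_pos] N_pos] AE_transfer_filter
  have "AE z in circle_measure. transfer N ?k (z ^ N) = ?k (z ^ N)"
  proof eventually_elim
    case (elim z)
    have "transfer N ?k (z ^ N) = transfer N (\<lambda>w. (cmod (m0 w))\<^sup>2 * ?k (w ^ N)) (z ^ N)"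
    proof (rule transfer_cong)
      fix w assume "w ^ N = z ^ N"
      with elim(1) have w: "h w > 0" "h (w ^ N) > 0" "h (w ^ N) = (cmod (m0 w))\<^sup>2 * h w" by blast+
      then have "cmod (m0 w) \<noteq> 0" by auto
      with w(1) show "?k w = (cmod (m0 w))\<^sup>2 * ?k (w ^ N)"
        unfolding w(3) by (simp add: field_simps abs_mult)
    qed
    also have "\<dots> = ?k (z ^ N)"
      using elim(2) by (simp only: transfer_mult_power[of N "\<lambda>w. (cmod (m0 w))\<^sup>2" ?k] mult_1)
    finally show ?case .
  qed
  then have "AE z in circle_measure. transfer N ?k z = ?k z"
    by (rule AE_from_power)
  then obtain \<kappa> where const: "AE z in circle_measure. ?k z = \<kappa>"
    by (rule AE_eq_const_if_transfer_fixed_nonneg[rotated 3]) (use N_ge_2 in auto)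
  have modulus: "AE z in circle_measure. (cmod (m0 z))\<^sup>2 = 1"
    using const AE_power[OF const N_pos] pos AE_power[OF pos N_pos] cob
    by eventually_elim (auto simp: field_simps)
  obtain e where e: "e > 0" "continuous_on (sphere 0 1 \<inter> ball 1 e) m0"
    and m01: "m0 1 = complex_of_real (sqrt (real N))"
    using wavelet_filter by (auto simp: wavelet_filter_def)
  have "sqrt (real N) > 1" using N_ge_2 by simp
  then obtain d where d: "d > 0"
    "\<And>z. z \<in> sphere 0 1 \<inter> ball 1 e \<Longrightarrow> dist z 1 < d \<Longrightarrow> dist (m0 z) (m0 1) < sqrt (real N) - 1"
    using e unfolding continuous_on_iff
    by (metis (no_types, lifting) Int_iff centre_in_ball diff_gt_0_iff_gt mem_sphere_0 norm_one)
  have "AE z in circle_measure. \<not> dist z 1 < min d e"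
    using modulus AE_space
  proof eventually_elim
    case (elim z)
    show ?case
    proof
      assume "dist z 1 < min d e"
      then have "dist (m0 z) (m0 1) < sqrt (real N) - 1"
        using elim d(2)[of z] by (auto simp: dist_commute)
      moreover have "cmod (m0 1) = sqrt (real N)" by (simp add: m01)
      moreover have "cmod (m0 1) \<le> cmod (m0 z) + dist (m0 z) (m0 1)"
        by (metis add.commute dist_commute dist_norm norm_triangle_sub)
      ultimately have "cmod (m0 z) > 1" by linarith
      then show False using elim(1) by (simp add: power2_eq_1_iff)
    qed
  qed
  then show False using not_AE_outside_ball[of "min d e"] d(1) e(1) by simp
qed

lemma AE_weighted: "(AE z in weighted h. P z) \<longleftrightarrow> (AE z in circle_measure. h z > 0 \<longrightarrow> P z)"
  unfolding weighted_def by (subst AE_density) auto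

lemma sets_weighted [measurable_cong]: "sets (weighted h) = sets circle_measure"
  by (simp add: weighted_def)

lemma integrable_weighted:
  assumes "f \<in> borel_measurable circle_measure"
  shows "integrable (weighted h) f \<longleftrightarrow> integrable circle_measure (\<lambda>z. h z * f z :: real)"
  unfolding weighted_def using h_nonneg assms by (subst integrable_density) auto

lemma square_integrable_iff:
  "\<xi> \<in> square_integrable h \<longleftrightarrow> \<xi> \<in> borel_measurable circle_measure \<and>
    integrable circle_measure (\<lambda>z. h z * (cmod (\<xi> z))\<^sup>2)"
  by (auto simp: square_integrable_def integrable_weighted measurable_cong_sets[OF sets_weighted refl])

lemma transfer_density_S0:
  "transfer N (\<lambda>w. h w * (cmod (m0 w * \<xi> (w ^ N)))\<^sup>2) z = ruelle N m0 h z * (cmod (\<xi> z))\<^sup>2"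
proof -
  have "(\<lambda>w. h w * (cmod (m0 w * \<xi> (w ^ N)))\<^sup>2)
      = (\<lambda>w. ((cmod (m0 w))\<^sup>2 * h w) * (\<lambda>v. (cmod (\<xi> v))\<^sup>2) (w ^ N))"
    by (simp add: norm_mult power_mult_distrib fun_eq_iff)
  then show ?thesis
    using transfer_mult_power[of N "\<lambda>w. (cmod (m0 w))\<^sup>2 * h w" "\<lambda>v. (cmod (\<xi> v))\<^sup>2" z]
    by (simp add: ruelle_eq_transfer)
qed

text \<open>The densities \<open>f n = h \<bar>\<xi> n\<bar>\<^sup>2\<close> are successive transfers of \<open>f 0\<close> and so converge in \<open>L\<^sup>1\<close>
to a constant. If it were positive, the orbit relation would pass to the limit as the
coboundary equation excluded by \<open>no_coboundary\<close>.\<close>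

theorem backward_orbit_vanishes:
  assumes L2: "\<And>n. \<xi> n \<in> square_integrable h"
    and orbit: "\<And>n. AE z in weighted h. \<xi> n z = m0 z * \<xi> (Suc n) (z ^ N)"
  shows "AE z in weighted h. \<xi> 0 z = 0"
proof -
  define f where "f n z = h z * (cmod (\<xi> n z))\<^sup>2" for n z
  have int: "integrable circle_measure (f n)" for n
    using L2 unfolding f_def square_integrable_iff by simp
  have [measurable]: "f n \<in> borel_measurable circle_measure" for n using int by auto
  have f_orbit: "AE z in circle_measure. f n z = h z * (cmod (m0 z * \<xi> (Suc n) (z ^ N)))\<^sup>2" for n
    using orbit[of n] h_nonneg unfolding AE_weighted by eventually_elim (auto simp: f_def)
  have f_Suc: "AE z in circle_measure. transfer N (f n) z = f (Suc n) z" for n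
    using AE_all_roots[OF f_orbit[of n] N_pos] harmonic
  proof eventually_elim
    case (elim z)
    have "transfer N (f n) z = transfer N (\<lambda>w. h w * (cmod (m0 w * \<xi> (Suc n) (w ^ N)))\<^sup>2) z"
      using elim(1) by (intro transfer_cong) auto
    then show ?case by (simp add: transfer_density_S0 elim(2) f_def)
  qed
  have f_iterate: "AE z in circle_measure. transfer (N ^ n) (f 0) z = f n z" for n
  proof (induction n)
    case 0
    show ?case by (simp add: transfer_def)
  next
    case (Suc n)
    from AE_all_roots[OF Suc N_pos] f_Suc[of n] show ?case
    proof eventually_elim
      case (elim z)
      have "transfer (N ^ Suc n) (f 0) z = transfer N (transfer (N ^ n) (f 0)) z"
        using N_pos by (simp add: transfer_transfer mult.commute)
      also have "\<dots> = transfer N (f n) z"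
        using elim(1) by (intro transfer_cong) auto
      finally show ?case using elim(2) by simp
    qed
  qed
  define c where "c = (\<integral>z. f 0 z \<partial>circle_measure)"
  have lim: "(\<lambda>n. \<integral>\<^sup>+z. ennreal \<bar>f n z - c\<bar> \<partial>circle_measure) \<longlonglongrightarrow> 0"
  proof -
    have "(\<integral>\<^sup>+z. ennreal \<bar>transfer (N ^ n) (f 0) z - c\<bar> \<partial>circle_measure)
        = (\<integral>\<^sup>+z. ennreal \<bar>f n z - c\<bar> \<partial>circle_measure)" for n
      using f_iterate[of n] by (intro nn_integral_cong_AE) auto
    then show ?thesis
      using transfer_iterate_equidistributes[OF int N_ge_2, of 0] by (simp add: c_def)
  qed
  have f_nonneg: "AE z in circle_measure. 0 \<le> f n z" for n
    using h_nonneg by eventually_elim (simp add: f_def)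
  have "c = 0"
  proof (rule ccontr)
    assume "c \<noteq> 0"
    then have "c > 0" using f_nonneg[of 0] integral_nonneg_AE[of "f 0"] by (fastforce simp: c_def)
    \<comment> \<open>Summing two consecutive deviations makes one subsequence work for both \<open>f n\<close> and \<open>f (Suc n)\<close>.\<close>
    let ?u = "\<lambda>n z. \<bar>f n z - c\<bar> + \<bar>f (Suc n) z - c\<bar>"
    have int_u: "integrable circle_measure (?u n)" for n
      using int by (intro Bochner_Integration.integrable_add integrable_abs Bochner_Integration.integrable_diff) auto
    have "(\<lambda>n. \<integral>z. norm (?u n z) \<partial>circle_measure) \<longlonglongrightarrow> 0"
    proof -
      have "ennreal (\<integral>z. norm (?u n z) \<partial>circle_measure)
          = (\<integral>\<^sup>+z. ennreal \<bar>f n z - c\<bar> \<partial>circle_measure) + (\<integral>\<^sup>+z. ennreal \<bar>f (Suc n) z - c\<bar> \<partial>circle_measure)" for n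
        using int_u[of n]
        by (subst nn_integral_eq_integral[symmetric]) (auto simp: nn_integral_add ennreal_plus)
      moreover have "(\<lambda>n. (\<integral>\<^sup>+z. ennreal \<bar>f n z - c\<bar> \<partial>circle_measure)
          + (\<integral>\<^sup>+z. ennreal \<bar>f (Suc n) z - c\<bar> \<partial>circle_measure)) \<longlonglongrightarrow> 0 + 0"
        by (intro tendsto_add lim LIMSEQ_Suc[OF lim])
      ultimately have "(\<lambda>n. ennreal (\<integral>z. norm (?u n z) \<partial>circle_measure)) \<longlonglongrightarrow> 0" by simp
      then show ?thesis by (subst (asm) ennreal_tendsto_0_iff) auto
    qed
    from tendsto_L1_AE_subseq[OF int_u this] obtain r where
      "AE z in circle_measure. (\<lambda>k. ?u (r k) z) \<longlonglongrightarrow> 0" by blast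
    then have conv: "AE z in circle_measure.
        ((\<lambda>k. f (r k) z) \<longlonglongrightarrow> c) \<and> ((\<lambda>k. f (Suc (r k)) z) \<longlonglongrightarrow> c)"
    proof eventually_elim
      case (elim z)
      have "(\<lambda>k. f (r k) z - c) \<longlonglongrightarrow> 0" "(\<lambda>k. f (Suc (r k)) z - c) \<longlonglongrightarrow> 0"
        by (rule tendsto_rabs_zero_cancel, rule tendsto_sandwich[OF _ _ tendsto_const elim], auto)+
      then show ?case by (simp add: LIM_zero_iff)
    qed
    have pos: "AE z in circle_measure. h z > 0"
      using conv h_nonneg
    proof eventually_elim
      case (elim z)
      have "h z \<noteq> 0"
      proof
        assume "h z = 0"
        then have "(\<lambda>k. 0) \<longlonglongrightarrow> c" using elim(1) by (simp add: f_def)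
        then show False using \<open>c \<noteq> 0\<close> by (simp add: LIMSEQ_const_iff)
      qed
      then show ?case using elim(2) by simp
    qed
    have "AE z in circle_measure. \<forall>n. f n z = h z * (cmod (m0 z * \<xi> (Suc n) (z ^ N)))\<^sup>2"
      using f_orbit by (simp add: AE_all_countable)
    then have "AE z in circle_measure. h (z ^ N) = (cmod (m0 z))\<^sup>2 * h z"
      using conv AE_power[OF conv N_pos]
    proof eventually_elim
      case (elim z)
      have eq: "f n z * h (z ^ N) = ((cmod (m0 z))\<^sup>2 * h z) * f (Suc n) (z ^ N)" for n
      proof -
        have "f n z * h (z ^ N) = (h z * (cmod (m0 z * \<xi> (Suc n) (z ^ N)))\<^sup>2) * h (z ^ N)"
          using elim(1) by simp
        then show ?thesis by (auto simp: f_def norm_mult power_mult_distrib)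
      qed
      have "(\<lambda>k. f (r k) z * h (z ^ N)) \<longlonglongrightarrow> c * h (z ^ N)"
        using elim(2) by (intro tendsto_intros) auto
      moreover have "(\<lambda>k. f (r k) z * h (z ^ N)) \<longlonglongrightarrow> ((cmod (m0 z))\<^sup>2 * h z) * c"
        unfolding eq using elim(3) by (intro tendsto_intros) auto
      ultimately have "c * h (z ^ N) = ((cmod (m0 z))\<^sup>2 * h z) * c"
        by (rule LIMSEQ_unique)
      then show ?case using \<open>c \<noteq> 0\<close> by simp
    qed
    then show False using no_coboundary pos by blast
  qed
  then have "AE z in circle_measure. f 0 z = 0"
    using integral_nonneg_eq_0_iff_AE[OF int f_nonneg, of 0] by (simp add: c_def)
  then show ?thesis
    unfolding AE_weighted by eventually_elim (auto simp: f_def)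
qed

end

section \<open>Limits of rapidly convergent square-integrable sequences\<close>

lemma ennreal_cmod_add_sq_le:
  "ennreal ((cmod (a + b))\<^sup>2) \<le> 2 * ennreal ((cmod a)\<^sup>2) + 2 * ennreal ((cmod b)\<^sup>2)"
proof -
  have "(cmod (a + b))\<^sup>2 \<le> (cmod a + cmod b)\<^sup>2"
    by (intro power_mono norm_triangle_ineq) simp
  also have "\<dots> \<le> 2 * (cmod a)\<^sup>2 + 2 * (cmod b)\<^sup>2"
    using zero_le_power2[of "cmod a - cmod b"] by (simp add: power2_eq_square algebra_simps)
  finally have "ennreal ((cmod (a + b))\<^sup>2) \<le> ennreal (2 * (cmod a)\<^sup>2 + 2 * (cmod b)\<^sup>2)"
    by (rule ennreal_leI)
  then show ?thesis by (simp add: ennreal_plus ennreal_mult)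
qed

text \<open>The elementary bound \<open>t \<le> t\<^sup>2 / c + c\<close>, integrated. With \<open>c\<close> chosen for each function it turns
smallness in \<open>L\<^sup>2\<close> into smallness in \<open>L\<^sup>1\<close>.\<close>

lemma (in finite_measure) nn_integral_norm_le:
  fixes f :: "'a \<Rightarrow> complex"
  assumes [measurable]: "f \<in> borel_measurable M" and "c > 0"
  shows "(\<integral>\<^sup>+z. ennreal (cmod (f z)) \<partial>M)
    \<le> ennreal (1 / c) * (\<integral>\<^sup>+z. ennreal ((cmod (f z))\<^sup>2) \<partial>M) + ennreal c * emeasure M (space M)"
proof -
  have "ennreal (cmod a) \<le> ennreal (1 / c) * ennreal ((cmod a)\<^sup>2) + ennreal c" for a
  proof -
    have "cmod a * c \<le> (cmod a)\<^sup>2 + c\<^sup>2"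
      using zero_le_power2[of "cmod a - c"] zero_le_power2[of "cmod a"] zero_le_power2[of c]
      unfolding power2_diff by linarith
    then have "cmod a \<le> 1 / c * (cmod a)\<^sup>2 + c"
      using \<open>c > 0\<close> by (simp add: field_simps power2_eq_square)
    then have "ennreal (cmod a) \<le> ennreal (1 / c * (cmod a)\<^sup>2 + c)"
      by (rule ennreal_leI)
    then show ?thesis
      using \<open>c > 0\<close> by (simp only: ennreal_plus ennreal_mult zero_le_power2 mult_nonneg_nonneg
          zero_le_divide_1_iff less_imp_le)
  qed
  then have "(\<integral>\<^sup>+z. ennreal (cmod (f z)) \<partial>M)
      \<le> (\<integral>\<^sup>+z. ennreal (1 / c) * ennreal ((cmod (f z))\<^sup>2) + ennreal c \<partial>M)"
    by (intro nn_integral_mono) simp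
  also have "\<dots> = ennreal (1 / c) * (\<integral>\<^sup>+z. ennreal ((cmod (f z))\<^sup>2) \<partial>M) + ennreal c * emeasure M (space M)"
    by (simp add: nn_integral_add nn_integral_cmult)
  finally show ?thesis .
qed

text \<open>The Riesz-Fischer argument for sequences that are Cauchy at a geometric rate. Consecutive
differences are summable in \<open>L\<^sup>1\<close>, so the sequence converges almost everywhere, and Fatou's
lemma transfers the Cauchy estimate to the limit.\<close>

lemma (in finite_measure) square_integrable_rapid_Cauchy_limit:
  fixes g :: "nat \<Rightarrow> 'a \<Rightarrow> complex"
  assumes g [measurable]: "\<And>k. g k \<in> borel_measurable M" and "0 \<le> B"
    and rapid: "\<And>k n. k \<le> n \<Longrightarrow>
      (\<integral>\<^sup>+z. ennreal ((cmod (g n z - g k z))\<^sup>2) \<partial>M) \<le> ennreal (B * (1 / 16) ^ k)"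
  obtains \<xi> where "\<xi> \<in> borel_measurable M"
    "\<And>k. (\<integral>\<^sup>+z. ennreal ((cmod (\<xi> z - g k z))\<^sup>2) \<partial>M) \<le> ennreal (B * (1 / 16) ^ k)"
proof -
  define \<mu> where "\<mu> = measure M (space M)"
  have \<mu>: "emeasure M (space M) = ennreal \<mu>" "0 \<le> \<mu>"
    by (simp_all add: \<mu>_def emeasure_eq_measure)
  let ?d = "\<lambda>k z. g (Suc k) z - g k z"
  have d: "(\<integral>\<^sup>+z. ennreal (cmod (?d k z)) \<partial>M) \<le> ennreal (B * (1 / 4) ^ k + \<mu> * (1 / 4) ^ k)" for k
  proof -
    \<comment> \<open>With \<open>c = 4\<^sup>-\<^sup>k\<close> both terms of the bound, \<open>16\<^sup>-\<^sup>k / c\<close> and \<open>c\<close>, are summable.\<close>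
    have "(\<integral>\<^sup>+z. ennreal (cmod (?d k z)) \<partial>M)
        \<le> ennreal (1 / (1 / 4) ^ k) * (\<integral>\<^sup>+z. ennreal ((cmod (?d k z))\<^sup>2) \<partial>M) + ennreal ((1 / 4) ^ k) * ennreal \<mu>"
      using nn_integral_norm_le[of "?d k" "(1 / 4) ^ k"] by (simp add: \<mu>)
    also have "\<dots> \<le> ennreal (1 / (1 / 4) ^ k) * ennreal (B * (1 / 16) ^ k) + ennreal ((1 / 4) ^ k) * ennreal \<mu>"
      by (intro add_mono mult_left_mono rapid) auto
    also have "\<dots> = ennreal (1 / (1 / 4) ^ k * (B * (1 / 16) ^ k) + (1 / 4) ^ k * \<mu>)"
      using \<open>0 \<le> B\<close> \<mu>(2) by (simp only: ennreal_plus ennreal_mult mult_nonneg_nonneg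
          zero_le_power zero_le_divide_1_iff zero_le_numeral)
    also have "1 / (1 / 4) ^ k * (B * (1 / 16) ^ k) = B * (1 / 4) ^ k"
    proof -
      have "(1 / 16 :: real) ^ k = (1 / 4) ^ k * (1 / 4) ^ k"
        by (simp flip: power_mult_distrib)
      then show ?thesis by simp
    qed
    finally show ?thesis by (simp add: mult.commute)
  qed
  have summ: "summable (\<lambda>k. B * (1 / 4) ^ k + \<mu> * (1 / 4 :: real) ^ k)"
    by (intro summable_add summable_mult summable_geometric) auto
  have "(\<integral>\<^sup>+z. (\<Sum>k. ennreal (cmod (?d k z))) \<partial>M) = (\<Sum>k. \<integral>\<^sup>+z. ennreal (cmod (?d k z)) \<partial>M)"
    by (rule nn_integral_suminf) measurable
  also have "\<dots> \<le> (\<Sum>k. ennreal (B * (1 / 4) ^ k + \<mu> * (1 / 4) ^ k))"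
    by (intro suminf_le d) auto
  also have "\<dots> < \<infinity>"
    using summ \<open>0 \<le> B\<close> \<mu>(2) by (subst suminf_ennreal2) auto
  finally have "AE z in M. (\<Sum>k. ennreal (cmod (?d k z))) \<noteq> \<infinity>"
    by (intro nn_integral_PInf_AE) auto
  then have conv: "AE z in M. (\<lambda>k. g k z) \<longlonglongrightarrow> lim (\<lambda>k. g k z)"
  proof eventually_elim
    case (elim z)
    then have "summable (\<lambda>k. cmod (?d k z))"
      by (intro summable_suminf_not_top) (auto simp: top_unique)
    then have "summable (\<lambda>k. ?d k z)" by (rule summable_norm_cancel)
    then have "convergent (\<lambda>n. \<Sum>k<n. ?d k z)"
      by (simp add: summable_iff_convergent)
    then have "convergent (\<lambda>n. g n z - g 0 z)"
      by (simp only: sum_lessThan_telescope[of "\<lambda>k. g k z"])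
    then have "convergent (\<lambda>n. g n z)"
      by (simp add: convergent_diff_const_right_iff)
    then show ?case by (simp add: convergent_LIMSEQ_iff)
  qed
  define \<xi> where "\<xi> z = lim (\<lambda>k. g k z)" for z
  have [measurable]: "\<xi> \<in> borel_measurable M"
    unfolding \<xi>_def[abs_def] by (rule borel_measurable_lim_metric) measurable
  show thesis
  proof (rule that)
    fix k
    have "(\<integral>\<^sup>+z. ennreal ((cmod (\<xi> z - g k z))\<^sup>2) \<partial>M)
        = (\<integral>\<^sup>+z. liminf (\<lambda>n. ennreal ((cmod (g n z - g k z))\<^sup>2)) \<partial>M)"
    proof (rule nn_integral_cong_AE)
      show "AE z in M. ennreal ((cmod (\<xi> z - g k z))\<^sup>2) = liminf (\<lambda>n. ennreal ((cmod (g n z - g k z))\<^sup>2))"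
        using conv
      proof eventually_elim
        case (elim z)
        then have "(\<lambda>n. ennreal ((cmod (g n z - g k z))\<^sup>2)) \<longlonglongrightarrow> ennreal ((cmod (\<xi> z - g k z))\<^sup>2)"
          unfolding \<xi>_def by (intro tendsto_ennrealI tendsto_intros)
        then show ?case by (rule lim_imp_Liminf[OF trivial_limit_sequentially, symmetric])
      qed
    qed
    also have "\<dots> \<le> liminf (\<lambda>n. \<integral>\<^sup>+z. ennreal ((cmod (g n z - g k z))\<^sup>2) \<partial>M)"
      by (rule nn_integral_liminf) measurable
    also have "\<dots> \<le> liminf (\<lambda>n. ennreal (B * (1 / 16) ^ k))"
      by (intro Liminf_mono eventually_sequentiallyI[of k] rapid)
    also have "\<dots> = ennreal (B * (1 / 16) ^ k)"
      by (simp add: Liminf_const)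
    finally show "(\<integral>\<^sup>+z. ennreal ((cmod (\<xi> z - g k z))\<^sup>2) \<partial>M) \<le> ennreal (B * (1 / 16) ^ k)" .
  qed measurable
qed

section \<open>The isometry on almost-everywhere classes\<close>

context harmonic_filter
begin

text \<open>The squared norm of \<open>L\<^sup>2(h)\<close>, with value \<open>\<infinity>\<close> at measurable functions outside this space.\<close>

definition sqnorm :: "(complex \<Rightarrow> complex) \<Rightarrow> ennreal" where
  "sqnorm \<xi> = (\<integral>\<^sup>+z. ennreal ((cmod (\<xi> z))\<^sup>2) \<partial>weighted h)"

text \<open>The operator \<open>S\<^sub>0\<close> on functions instead of almost-everywhere classes.\<close>

definition filter_op :: "(complex \<Rightarrow> complex) \<Rightarrow> complex \<Rightarrow> complex" where
  "filter_op \<xi> z = m0 z * \<xi> (z ^ N)"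

lemma finite_measure_weighted: "finite_measure (weighted h)"
proof (rule finite_measureI)
  have "emeasure (weighted h) (space (weighted h)) = (\<integral>\<^sup>+z. ennreal (h z) \<partial>circle_measure)"
    unfolding weighted_def by (subst emeasure_density) (use sets.top[of circle_measure] in \<open>auto intro!: nn_integral_cong\<close>)
  also have "\<dots> = ennreal (\<integral>z. h z \<partial>circle_measure)"
    using h_integrable h_nonneg by (intro nn_integral_eq_integral)
  finally show "emeasure (weighted h) (space (weighted h)) \<noteq> \<infinity>" by simp
qed

lemma measurable_weighted: "borel_measurable (weighted h) = borel_measurable circle_measure"
  by (rule measurable_cong_sets[OF sets_weighted refl])

lemma sqnorm_eq:
  assumes "\<xi> \<in> borel_measurable circle_measure"
  shows "sqnorm \<xi> = (\<integral>\<^sup>+z. ennreal (\<bar>h z\<bar> * (cmod (\<xi> z))\<^sup>2) \<partial>circle_measure)"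
proof -
  have "sqnorm \<xi> = (\<integral>\<^sup>+z. ennreal (h z) * ennreal ((cmod (\<xi> z))\<^sup>2) \<partial>circle_measure)"
    unfolding sqnorm_def weighted_def using assms by (intro nn_integral_density) auto
  also have "\<dots> = (\<integral>\<^sup>+z. ennreal (\<bar>h z\<bar> * (cmod (\<xi> z))\<^sup>2) \<partial>circle_measure)"
    using h_nonneg by (intro nn_integral_cong_AE) (auto simp: ennreal_mult elim!: eventually_mono)
  finally show ?thesis .
qed

lemma square_integrable_iff_sqnorm:
  "\<xi> \<in> square_integrable h \<longleftrightarrow> \<xi> \<in> borel_measurable circle_measure \<and> sqnorm \<xi> < \<infinity>"
  by (auto simp: square_integrable_def sqnorm_def measurable_weighted integrable_iff_bounded)

lemma filter_op_measurable [measurable]: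
  assumes [measurable]: "\<xi> \<in> borel_measurable circle_measure"
  shows "filter_op \<xi> \<in> borel_measurable circle_measure"
  unfolding filter_op_def[abs_def] by measurable

text \<open>\<open>S\<^sub>0\<close> is isometric: the transfer operator preserves the integral of the density of
\<open>S\<^sub>0 \<xi>\<close> and, as \<open>h\<close> is harmonic, maps this density to that of \<open>\<xi>\<close>.\<close>

lemma sqnorm_filter_op:
  assumes [measurable]: "\<xi> \<in> borel_measurable circle_measure"
  shows "sqnorm (filter_op \<xi>) = sqnorm \<xi>"
proof -
  let ?g = "\<lambda>w. \<bar>h w\<bar> * (cmod (filter_op \<xi> w))\<^sup>2"
  have "AE z in circle_measure. transfer N ?g z = \<bar>h z\<bar> * (cmod (\<xi> z))\<^sup>2"
    using AE_all_roots[OF h_nonneg N_pos] harmonic h_nonneg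
  proof eventually_elim
    case (elim z)
    have "transfer N ?g z = transfer N (\<lambda>w. h w * (cmod (m0 w * \<xi> (w ^ N)))\<^sup>2) z"
      using elim(1) by (intro transfer_cong) (simp add: filter_op_def)
    then show ?case using elim(2,3) by (simp add: transfer_density_S0)
  qed
  then have "(\<integral>\<^sup>+z. ennreal (\<bar>h z\<bar> * (cmod (\<xi> z))\<^sup>2) \<partial>circle_measure)
      = (\<integral>\<^sup>+z. ennreal (transfer N ?g z) \<partial>circle_measure)"
    by (intro nn_integral_cong_AE) (auto elim!: eventually_mono)
  also have "\<dots> = (\<integral>\<^sup>+z. ennreal (?g z) \<partial>circle_measure)"
    by (intro nn_integral_transfer N_pos) auto
  finally show ?thesis by (simp add: sqnorm_eq)
qed

lemma filter_op_square_integrable: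
  "\<xi> \<in> square_integrable h \<Longrightarrow> filter_op \<xi> \<in> square_integrable h"
  by (simp add: square_integrable_iff_sqnorm sqnorm_filter_op filter_op_measurable)

lemma sqnorm_eq_0_iff:
  assumes "\<xi> \<in> borel_measurable circle_measure"
  shows "sqnorm \<xi> = 0 \<longleftrightarrow> (AE z in weighted h. \<xi> z = 0)"
  unfolding sqnorm_def using assms
  by (subst nn_integral_0_iff_AE) (auto simp: measurable_weighted)

lemma sqnorm_cong_AE:
  "AE z in weighted h. \<xi> z = \<eta> z \<Longrightarrow> sqnorm \<xi> = sqnorm \<eta>"
  unfolding sqnorm_def by (intro nn_integral_cong_AE) (auto elim!: eventually_mono)

lemma filter_op_diff: "filter_op (\<lambda>z. \<xi> z - \<eta> z) = (\<lambda>z. filter_op \<xi> z - filter_op \<eta> z)"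
  by (simp add: filter_op_def fun_eq_iff right_diff_distrib)

text \<open>An isometry is injective; one direction also shows that \<open>S\<^sub>0\<close> respects classes.\<close>

lemma filter_op_AE_eq_iff:
  assumes [measurable]: "\<xi> \<in> borel_measurable circle_measure" "\<eta> \<in> borel_measurable circle_measure"
  shows "(AE z in weighted h. filter_op \<xi> z = filter_op \<eta> z) \<longleftrightarrow> (AE z in weighted h. \<xi> z = \<eta> z)"
proof -
  have "(AE z in weighted h. filter_op \<xi> z = filter_op \<eta> z)
      \<longleftrightarrow> sqnorm (filter_op (\<lambda>z. \<xi> z - \<eta> z)) = 0"
    by (subst sqnorm_eq_0_iff) (auto simp: filter_op_diff)
  also have "\<dots> \<longleftrightarrow> (AE z in weighted h. \<xi> z = \<eta> z)"
    by (simp add: sqnorm_filter_op sqnorm_eq_0_iff)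
  finally show ?thesis .
qed

lemma sqnorm_add_le:
  assumes [measurable]: "\<xi> \<in> borel_measurable circle_measure" "\<eta> \<in> borel_measurable circle_measure"
  shows "sqnorm (\<lambda>z. \<xi> z + \<eta> z) \<le> 2 * sqnorm \<xi> + 2 * sqnorm \<eta>"
proof -
  have "sqnorm (\<lambda>z. \<xi> z + \<eta> z)
      \<le> (\<integral>\<^sup>+z. 2 * ennreal ((cmod (\<xi> z))\<^sup>2) + 2 * ennreal ((cmod (\<eta> z))\<^sup>2) \<partial>weighted h)"
    unfolding sqnorm_def by (intro nn_integral_mono ennreal_cmod_add_sq_le)
  also have "\<dots> = 2 * sqnorm \<xi> + 2 * sqnorm \<eta>"
    unfolding sqnorm_def by (simp add: nn_integral_add nn_integral_cmult measurable_weighted)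
  finally show ?thesis .
qed

lemma L2_class_eq_iff:
  assumes "\<xi> \<in> square_integrable h" "\<eta> \<in> square_integrable h"
  shows "L2_class h \<xi> = L2_class h \<eta> \<longleftrightarrow> (AE z in weighted h. \<xi> z = \<eta> z)"
  unfolding L2_class_def using assms eq_equiv_class_iff[OF equiv_ae_rel assms]
  by (simp add: ae_rel_def)

lemma L2_eq_image: "L2 h = L2_class h ` square_integrable h"
  by (auto simp: L2_def L2_class_def quotient_def)

lemma S0_L2_class:
  assumes "\<xi> \<in> square_integrable h"
  shows "S0 N m0 h (L2_class h \<xi>) = L2_class h (filter_op \<xi>)"
proof -
  have eq: "ae_rel h `` {filter_op \<eta>} = ae_rel h `` {filter_op \<xi>}" if "(\<xi>, \<eta>) \<in> ae_rel h" for \<eta>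
  proof -
    have "\<eta> \<in> square_integrable h" "AE z in weighted h. \<xi> z = \<eta> z"
      using that by (auto simp: ae_rel_def)
    then show ?thesis
      using assms L2_class_eq_iff[OF filter_op_square_integrable filter_op_square_integrable, of \<xi> \<eta>]
      by (simp add: L2_class_def filter_op_AE_eq_iff square_integrable_iff_sqnorm)
  qed
  have "(\<xi>, \<xi>) \<in> ae_rel h" using assms by (simp add: ae_rel_def)
  have "S0 N m0 h (L2_class h \<xi>) = (\<Union>\<eta>\<in>ae_rel h `` {\<xi>}. ae_rel h `` {filter_op \<eta>})"
    by (auto simp: S0_def L2_class_def filter_op_def[abs_def])
  also have "\<dots> = ae_rel h `` {filter_op \<xi>}"
    using eq \<open>(\<xi>, \<xi>) \<in> ae_rel h\<close> by blast
  finally show ?thesis by (simp add: L2_class_def)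
qed

lemma filter_op_funpow_square_integrable:
  "\<xi> \<in> square_integrable h \<Longrightarrow> (filter_op ^^ n) \<xi> \<in> square_integrable h"
  by (induction n) (auto intro: filter_op_square_integrable)

lemma S0_funpow_L2_class:
  "\<xi> \<in> square_integrable h \<Longrightarrow> (S0 N m0 h ^^ n) (L2_class h \<xi>) = L2_class h ((filter_op ^^ n) \<xi>)"
  by (induction n) (auto simp: S0_L2_class filter_op_funpow_square_integrable)

lemma filter_op_funpow_AE_eqD:
  assumes "\<xi> \<in> square_integrable h" "\<eta> \<in> square_integrable h"
    and "AE z in weighted h. (filter_op ^^ n) \<xi> z = (filter_op ^^ n) \<eta> z"
  shows "AE z in weighted h. \<xi> z = \<eta> z"
  using assms(3)
proof (induction n)
  case (Suc n)
  have "(filter_op ^^ n) \<xi> \<in> borel_measurable circle_measure"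
    "(filter_op ^^ n) \<eta> \<in> borel_measurable circle_measure"
    using filter_op_funpow_square_integrable assms(1,2) by (auto simp: square_integrable_iff_sqnorm)
  with Suc show ?case by (simp add: filter_op_AE_eq_iff)
qed simp

lemma zero_square_integrable: "(\<lambda>z. 0) \<in> square_integrable h"
  by (simp add: square_integrable_iff_sqnorm sqnorm_def)

text \<open>Preimages of a class under the powers of \<open>S\<^sub>0\<close> form a backward orbit, since \<open>S\<^sub>0\<close> is injective.\<close>

theorem Inter_S0_range:
  "(\<Inter>n\<in>{1..}. (S0 N m0 h ^^ n) ` L2 h) = {L2_class h (\<lambda>z. 0)}"
proof (intro equalityI subsetI)
  fix C assume C: "C \<in> (\<Inter>n\<in>{1..}. (S0 N m0 h ^^ n) ` L2 h)"
  have "\<exists>\<xi>. \<xi> \<in> square_integrable h \<and> C = L2_class h ((filter_op ^^ Suc n) \<xi>)" for n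
  proof -
    have "C \<in> (S0 N m0 h ^^ Suc n) ` L2 h" using INT_D[OF C, of "Suc n"] by simp
    then show ?thesis
      unfolding L2_eq_image using S0_funpow_L2_class by blast
  qed
  then obtain \<xi> where L2: "\<And>n. \<xi> n \<in> square_integrable h"
    and C_eq: "\<And>n. C = L2_class h ((filter_op ^^ Suc n) (\<xi> n))" by metis
  have "AE z in weighted h. \<xi> n z = m0 z * \<xi> (Suc n) (z ^ N)" for n
  proof -
    have "L2_class h ((filter_op ^^ Suc n) (\<xi> n)) = L2_class h ((filter_op ^^ Suc n) (filter_op (\<xi> (Suc n))))"
      using C_eq[of n] C_eq[of "Suc n"] by (simp add: funpow_swap1)
    then have "AE z in weighted h. (filter_op ^^ Suc n) (\<xi> n) z = (filter_op ^^ Suc n) (filter_op (\<xi> (Suc n))) z"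
      using L2 by (subst (asm) L2_class_eq_iff)
        (auto intro!: filter_op_square_integrable filter_op_funpow_square_integrable)
    then have "AE z in weighted h. \<xi> n z = filter_op (\<xi> (Suc n)) z"
      by (rule filter_op_funpow_AE_eqD[OF L2 filter_op_square_integrable[OF L2]])
    then show ?thesis by (simp add: filter_op_def)
  qed
  from backward_orbit_vanishes[of \<xi>, OF L2 this]
  have "AE z in weighted h. \<xi> 0 z = (\<lambda>z. 0) z" by simp
  then have "AE z in weighted h. filter_op (\<xi> 0) z = filter_op (\<lambda>z. 0) z"
    using L2 by (subst filter_op_AE_eq_iff) (auto simp: square_integrable_iff_sqnorm)
  then have "L2_class h (filter_op (\<xi> 0)) = L2_class h (\<lambda>z. 0)"
    by (subst L2_class_eq_iff) (auto simp: filter_op_def L2 zero_square_integrable filter_op_square_integrable)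
  then show "C \<in> {L2_class h (\<lambda>z. 0)}" using C_eq[of 0] by simp
next
  fix C assume "C \<in> {L2_class h (\<lambda>z. 0)}"
  have zero: "filter_op (\<lambda>z. 0) = (\<lambda>z. 0)" by (simp add: filter_op_def fun_eq_iff)
  have "(filter_op ^^ n) (\<lambda>z. 0) = (\<lambda>z. 0)" for n
    by (induction n) (simp_all add: zero)
  then have "L2_class h (\<lambda>z. 0) = (S0 N m0 h ^^ n) (L2_class h (\<lambda>z. 0))" for n
    by (simp add: S0_funpow_L2_class zero_square_integrable)
  then show "C \<in> (\<Inter>n\<in>{1..}. (S0 N m0 h ^^ n) ` L2 h)"
    using \<open>C \<in> _\<close> zero_square_integrable by (auto simp: L2_eq_image)
qed

end

section \<open>Essentially bounded functions\<close>

lemma LinfE: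
  assumes "f \<in> Linf"
  obtains C where "AE z in circle_measure. cmod (f z) \<le> C" "0 \<le> C"
proof -
  from assms obtain C where "AE z in circle_measure. cmod (f z) \<le> C" by (auto simp: Linf_def)
  then have "AE z in circle_measure. cmod (f z) \<le> max C 0" by eventually_elim simp
  then show thesis by (rule that) simp
qed

lemma Linf_measurable: "f \<in> Linf \<Longrightarrow> f \<in> borel_measurable circle_measure"
  by (simp add: Linf_def)

lemma LinfI:
  "f \<in> borel_measurable circle_measure \<Longrightarrow> AE z in circle_measure. cmod (f z) \<le> C \<Longrightarrow> f \<in> Linf"
  by (auto simp: Linf_def)

lemma Linf_const: "(\<lambda>z. c) \<in> Linf"
  by (rule LinfI[where C = "cmod c"]) auto

lemma Linf_add:
  assumes "f \<in> Linf" "g \<in> Linf"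
  shows "(\<lambda>z. f z + g z) \<in> Linf"
proof -
  note [measurable] = assms[THEN Linf_measurable]
  obtain C D where "AE z in circle_measure. cmod (f z) \<le> C" "AE z in circle_measure. cmod (g z) \<le> D"
    using assms by (auto elim!: LinfE)
  then have "AE z in circle_measure. cmod (f z + g z) \<le> C + D"
    by eventually_elim (rule norm_triangle_mono)
  then show ?thesis by (intro LinfI) measurable
qed

lemma Linf_mult:
  assumes "f \<in> Linf" "g \<in> Linf"
  shows "(\<lambda>z. f z * g z) \<in> Linf"
proof -
  note [measurable] = assms[THEN Linf_measurable]
  obtain C D where ae: "AE z in circle_measure. cmod (f z) \<le> C" "AE z in circle_measure. cmod (g z) \<le> D"
    and "0 \<le> C" "0 \<le> D"
    using assms by (auto elim!: LinfE)
  from ae have "AE z in circle_measure. cmod (f z * g z) \<le> C * D"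
    by eventually_elim (use \<open>0 \<le> C\<close> in \<open>auto simp: norm_mult intro: mult_mono\<close>)
  then show ?thesis by (intro LinfI) measurable
qed

lemma Linf_diff:
  assumes "f \<in> Linf" "g \<in> Linf"
  shows "(\<lambda>z. f z - g z) \<in> Linf"
  using Linf_add[OF assms(1) Linf_mult[OF Linf_const[of "-1"] assms(2)]] by simp

lemma Linf_cnj:
  assumes "f \<in> Linf"
  shows "(\<lambda>z. cnj (f z)) \<in> Linf"
proof -
  have [measurable]: "cnj \<in> borel_measurable borel"
    by (intro borel_measurable_continuous_onI continuous_intros)
  note [measurable] = assms[THEN Linf_measurable]
  show ?thesis using assms by (auto elim!: LinfE intro!: LinfI)
qed

lemma Linf_power:
  assumes "f \<in> Linf" "M > 0"
  shows "(\<lambda>z. f (z ^ M)) \<in> Linf"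
proof -
  note [measurable] = assms(1)[THEN Linf_measurable]
  obtain C where "AE z in circle_measure. cmod (f z) \<le> C"
    using assms(1) by (auto elim!: LinfE)
  from AE_power[OF this assms(2)] show ?thesis by (intro LinfI) measurable
qed

lemma closure_rapid_sequence:
  fixes x :: "'a::real_normed_vector"
  assumes "x \<in> closure S"
  shows "\<exists>y. \<forall>k::nat. y k \<in> S \<and> norm (y k - x) \<le> (1 / 4) ^ k"
proof -
  have "\<exists>y\<in>S. dist y x < (1 / 4) ^ k" for k :: nat
    using assms closure_approachable[of x S] by simp
  then have "\<forall>k. \<exists>y\<in>S. norm (y - x) \<le> (1 / 4) ^ k"
    by (metis dist_norm less_imp_le)
  then show ?thesis by metis
qed

section \<open>Cyclic representations\<close>

locale harmonic_representation = harmonic_filter N m0 h + induced_cyclic_representation N m0 h \<pi> U \<phi>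
  for N :: nat and m0 :: "complex \<Rightarrow> complex" and h :: "complex \<Rightarrow> real"
    and \<pi> :: "(complex \<Rightarrow> complex) \<Rightarrow> ('v::complex_hilbert_space \<Rightarrow> 'v)"
    and U :: "'v \<Rightarrow> 'v" and \<phi> :: 'v
begin

lemma m0_Linf: "m0 \<in> Linf"
  using wavelet_filter by (simp add: wavelet_filter_def)

lemma filter_op_Linf: "f \<in> Linf \<Longrightarrow> filter_op f \<in> Linf"
  unfolding filter_op_def[abs_def] by (intro Linf_mult m0_Linf Linf_power N_pos)

lemma Linf_square_integrable:
  assumes "f \<in> Linf"
  shows "f \<in> square_integrable h"
proof -
  note [measurable] = assms[THEN Linf_measurable]
  obtain C where C: "AE z in circle_measure. cmod (f z) \<le> C" "0 \<le> C"
    using assms by (auto elim!: LinfE)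
  have "integrable circle_measure (\<lambda>z. h z * (cmod (f z))\<^sup>2)"
  proof (rule Bochner_Integration.integrable_bound)
    show "integrable circle_measure (\<lambda>z. C\<^sup>2 * h z)" using h_integrable by simp
    show "AE z in circle_measure. norm (h z * (cmod (f z))\<^sup>2) \<le> norm (C\<^sup>2 * h z)"
      using C(1)
    proof eventually_elim
      case (elim z)
      then have "(cmod (f z))\<^sup>2 \<le> C\<^sup>2" by (intro power_mono) auto
      then show ?case by (simp add: abs_mult mult.commute mult_left_mono)
    qed
  qed measurable
  then show ?thesis by (simp add: square_integrable_iff)
qed

lemma rep_diff_vec:
  assumes "f \<in> Linf" "g \<in> Linf"
  shows "\<pi> (\<lambda>z. f z - g z) x = \<pi> f x - \<pi> g x"
proof -
  have "\<pi> (\<lambda>z. f z + (-1) * g z) = (\<lambda>x. \<pi> f x + \<pi> (\<lambda>z. (-1) * g z) x)"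
    using assms by (intro rep_add Linf_mult[OF Linf_const])
  also have "\<pi> (\<lambda>z. (-1) * g z) = (\<lambda>x. (-1) *\<^sub>C \<pi> g x)"
    using assms by (intro rep_scale)
  finally show ?thesis
    using scaleC_of_real[of "-1"] by simp
qed

text \<open>The isometry of \<open>f \<mapsto> \<pi>(f)\<phi>\<close> for the norm of \<open>L\<^sup>2(h)\<close>, from
\<open>\<langle>\<pi>(f)\<phi>, \<pi>(f)\<phi>\<rangle> = \<langle>\<phi>, \<pi>(\<bar>f\<bar>\<^sup>2)\<phi>\<rangle>\<close>.\<close>

lemma norm_rep_cyclic:
  assumes f: "f \<in> Linf"
  shows "ennreal ((norm (\<pi> f \<phi>))\<^sup>2) = sqnorm f"
proof -
  have int: "integrable circle_measure (\<lambda>z. h z * (cmod (f z))\<^sup>2)"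
    using Linf_square_integrable[OF f] by (simp add: square_integrable_iff)
  have "cinner (\<pi> f \<phi>) (\<pi> f \<phi>) = cinner \<phi> ((\<pi> (\<lambda>z. cnj (f z)) \<circ> \<pi> f) \<phi>)"
    using f by (simp add: rep_star)
  also have "\<dots> = cinner \<phi> (\<pi> (\<lambda>z. cnj (f z) * f z) \<phi>)"
    using f by (simp add: rep_mult Linf_cnj)
  also have "\<dots> = (LINT z|circle_measure. cnj (f z) * f z * complex_of_real (h z))"
    using f by (intro state Linf_mult Linf_cnj)
  also have "\<dots> = (LINT z|circle_measure. complex_of_real (h z * (cmod (f z))\<^sup>2))"
    by (intro Bochner_Integration.integral_cong refl)
       (simp add: complex_norm_square[unfolded of_real_power] mult.commute mult.left_commute)
  also have "\<dots> = complex_of_real (LINT z|circle_measure. h z * (cmod (f z))\<^sup>2)"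
    by (rule integral_complex_of_real)
  finally have "(norm (\<pi> f \<phi>))\<^sup>2 = (LINT z|circle_measure. h z * (cmod (f z))\<^sup>2)"
    by (simp add: power2_norm_eq_inner flip: Re_cinner)
  also have "ennreal \<dots> = (\<integral>\<^sup>+z. ennreal (h z * (cmod (f z))\<^sup>2) \<partial>circle_measure)"
    using int h_nonneg by (subst nn_integral_eq_integral) (auto elim!: eventually_mono)
  also have "\<dots> = sqnorm f"
    using h_nonneg f by (subst sqnorm_eq) (auto simp: Linf_measurable intro!: nn_integral_cong_AE elim!: eventually_mono)
  finally show ?thesis .
qed

lemma norm_rep_cyclic_diff:
  assumes "f \<in> Linf" "g \<in> Linf"
  shows "sqnorm (\<lambda>z. f z - g z) = ennreal ((norm (\<pi> f \<phi> - \<pi> g \<phi>))\<^sup>2)"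
  using norm_rep_cyclic[OF Linf_diff[OF assms]] by (simp add: rep_diff_vec[OF assms])

lemma U_linear: "bounded_linear U" and U_norm: "norm (U x) = norm x" and U_inj: "inj U"
proof -
  show lin: "bounded_linear U"
    using unitary by (simp add: unitary_op_def bounded_clinear_def)
  have norm: "norm (U x) = norm x" for x
    using unitary by (simp add: unitary_op_def norm_eq_sqrt_inner flip: Re_cinner)
  then show "norm (U x) = norm x" .
  interpret bounded_linear U by (rule lin)
  show "inj U"
  proof (rule injI)
    fix x y assume "U x = U y"
    then have "norm (U (x - y)) = 0" by (simp add: diff)
    then show "x = y" by (simp add: norm)
  qed
qed

lemma U_rep_cyclic:
  assumes "f \<in> Linf"
  shows "U (\<pi> f \<phi>) = \<pi> (filter_op f) \<phi>"
proof -
  have "U (\<pi> f \<phi>) = (U \<circ> \<pi> f \<circ> inv U) (U \<phi>)"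
    using U_inj by simp
  also have "\<dots> = (\<pi> (\<lambda>z. f (z ^ N)) \<circ> \<pi> m0) \<phi>"
    by (simp add: covariance[OF assms] scaling)
  also have "\<dots> = \<pi> (\<lambda>z. f (z ^ N) * m0 z) \<phi>"
    by (simp add: rep_mult Linf_power[OF assms N_pos] m0_Linf)
  also have "(\<lambda>z. f (z ^ N) * m0 z) = filter_op f"
    by (simp add: filter_op_def fun_eq_iff mult.commute)
  finally show ?thesis .
qed

text \<open>The vectors \<open>\<pi>(f)\<phi>\<close> already form a subspace.\<close>

lemma V0_eq: "V0 \<pi> \<phi> = closure {\<pi> f \<phi> | f. f \<in> Linf}"
proof -
  interpret V: vector_space "scaleC :: complex \<Rightarrow> 'v \<Rightarrow> 'v" by (rule vector_space_scaleC)
  have "V.subspace {\<pi> f \<phi> | f. f \<in> Linf}"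
  proof (rule V.subspaceI)
    have "\<pi> (\<lambda>z. 0 - 0) \<phi> = 0"
      using rep_diff_vec[OF Linf_const Linf_const, of 0 0] by simp
    then show "0 \<in> {\<pi> f \<phi> | f. f \<in> Linf}" using Linf_const[of 0] by force
    show "x + y \<in> {\<pi> f \<phi> | f. f \<in> Linf}"
      if xy: "x \<in> {\<pi> f \<phi> | f. f \<in> Linf}" "y \<in> {\<pi> f \<phi> | f. f \<in> Linf}" for x y
    proof -
      obtain f g where "f \<in> Linf" "g \<in> Linf" "x = \<pi> f \<phi>" "y = \<pi> g \<phi>" using xy by blast
      then have "x + y = \<pi> (\<lambda>z. f z + g z) \<phi>" "(\<lambda>z. f z + g z) \<in> Linf"
        by (simp_all add: rep_add Linf_add)
      then show ?thesis by blast
    qed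
    show "c *\<^sub>C x \<in> {\<pi> f \<phi> | f. f \<in> Linf}" if x: "x \<in> {\<pi> f \<phi> | f. f \<in> Linf}" for c x
    proof -
      obtain f where "f \<in> Linf" "x = \<pi> f \<phi>" using x by blast
      then have "c *\<^sub>C x = \<pi> (\<lambda>z. c * f z) \<phi>" "(\<lambda>z. c * f z) \<in> Linf"
        by (simp_all add: rep_scale Linf_mult Linf_const)
      then show ?thesis by blast
    qed
  qed
  then have "V.span {\<pi> f \<phi> | f. f \<in> Linf} = {\<pi> f \<phi> | f. f \<in> Linf}"
    by (simp only: V.span_eq_iff)
  then show ?thesis by (simp only: V0_def)
qed

text \<open>The graph of the unitary between \<open>L\<^sup>2(h)\<close> and \<open>V\<^sub>0(\<phi>)\<close> that extends \<open>f \<mapsto> \<pi>(f)\<phi>\<close>, as the closure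
of its restriction to bounded functions.\<close>

definition represents :: "(complex \<Rightarrow> complex) \<Rightarrow> 'v \<Rightarrow> bool" where
  "represents \<xi> x \<longleftrightarrow> \<xi> \<in> square_integrable h \<and>
     (\<exists>g. (\<forall>k. g k \<in> Linf) \<and> (\<lambda>k. \<pi> (g k) \<phi>) \<longlonglongrightarrow> x \<and> (\<lambda>k. sqnorm (\<lambda>z. \<xi> z - g k z)) \<longlonglongrightarrow> 0)"

lemma V0_represented:
  assumes "x \<in> V0 \<pi> \<phi>"
  obtains \<xi> where "represents \<xi> x"
proof -
  obtain y where y: "\<And>k. y k \<in> {\<pi> f \<phi> | f. f \<in> Linf}" "\<And>k::nat. norm (y k - x) \<le> (1 / 4) ^ k"
    using closure_rapid_sequence[OF assms[unfolded V0_eq]] by blast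
  have "\<forall>k. \<exists>g. g \<in> Linf \<and> y k = \<pi> g \<phi>" using y(1) by blast
  then obtain g where g: "\<And>k. g k \<in> Linf" and y_eq: "\<And>k. y k = \<pi> (g k) \<phi>" by metis
  have close: "sqnorm (\<lambda>z. g n z - g k z) \<le> ennreal (4 * (1 / 16) ^ k)" if "k \<le> n" for k n
  proof -
    have "norm (y n - y k) \<le> norm (y n - x) + norm (y k - x)"
      by (metis norm_minus_commute norm_triangle_sub diff_add_cancel norm_triangle_ineq add_diff_eq)
    also have "\<dots> \<le> (1 / 4) ^ k + (1 / 4) ^ k"
    proof -
      have "(1 / 4 :: real) ^ n \<le> (1 / 4) ^ k" by (intro power_decreasing that) auto
      then show ?thesis using y(2)[of n] y(2)[of k] by linarith
    qed
    finally have "(norm (y n - y k))\<^sup>2 \<le> (2 * (1 / 4) ^ k)\<^sup>2"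
      by (intro power_mono) auto
    also have "\<dots> = 4 * (1 / 16) ^ k"
      by (simp add: power2_eq_square flip: power_mult_distrib)
    finally show ?thesis
      by (simp add: norm_rep_cyclic_diff g y_eq ennreal_leI)
  qed
  interpret weighted: finite_measure "weighted h" by (rule finite_measure_weighted)
  obtain \<xi> where \<xi>: "\<xi> \<in> borel_measurable (weighted h)"
    "\<And>k. sqnorm (\<lambda>z. \<xi> z - g k z) \<le> ennreal (4 * (1 / 16) ^ k)"
    using weighted.square_integrable_rapid_Cauchy_limit[of g 4] close g
    by (auto simp: sqnorm_def measurable_weighted Linf_measurable)
  have [measurable]: "\<xi> \<in> borel_measurable circle_measure" "g k \<in> borel_measurable circle_measure" for k
    using \<xi>(1) g by (auto simp: measurable_weighted Linf_measurable)
  have "sqnorm (\<lambda>z. (\<xi> z - g 0 z) + g 0 z) \<le> 2 * sqnorm (\<lambda>z. \<xi> z - g 0 z) + 2 * sqnorm (g 0)"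
    by (rule sqnorm_add_le) measurable
  also have "\<dots> < \<infinity>"
    using \<xi>(2)[of 0] Linf_square_integrable[OF g, of 0]
    by (auto simp: square_integrable_iff_sqnorm ennreal_mult_less_top ennreal_add_less_top
        intro: le_less_trans)
  finally have "\<xi> \<in> square_integrable h"
    by (simp add: square_integrable_iff_sqnorm)
  moreover have "(\<lambda>k. \<pi> (g k) \<phi>) \<longlonglongrightarrow> x"
  proof -
    have "(\<lambda>k. (1 / 4 :: real) ^ k) \<longlonglongrightarrow> 0" by (rule LIMSEQ_power_zero) simp
    then have "(\<lambda>k. y k - x) \<longlonglongrightarrow> 0"
      by (rule Lim_null_comparison[rotated]) (simp add: y(2))
    then show ?thesis by (simp add: y_eq LIM_zero_iff)
  qed
  moreover have "(\<lambda>k. sqnorm (\<lambda>z. \<xi> z - g k z)) \<longlonglongrightarrow> 0"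
  proof (rule tendsto_0_le_ennreal)
    have "(\<lambda>k. ennreal (4 * (1 / 16) ^ k)) \<longlonglongrightarrow> ennreal (4 * 0)"
      by (intro tendsto_ennrealI tendsto_intros LIMSEQ_power_zero) simp
    then show "(\<lambda>k. ennreal (4 * (1 / 16) ^ k)) \<longlonglongrightarrow> 0" by simp
  qed (simp add: \<xi>(2))
  ultimately show thesis
    using g by (intro that[of \<xi>]) (auto simp: represents_def)
qed

text \<open>\<open>U\<close> and \<open>S\<^sub>0\<close> agree on bounded functions and are both isometric, so they correspond to each
other on the closure.\<close>

lemma represents_U:
  assumes "represents \<xi> (U x)" "represents \<eta> x"
  shows "AE z in weighted h. \<xi> z = filter_op \<eta> z"
proof -
  obtain a b where a: "\<And>k. a k \<in> Linf" "(\<lambda>k. \<pi> (a k) \<phi>) \<longlonglongrightarrow> U x" "(\<lambda>k. sqnorm (\<lambda>z. \<xi> z - a k z)) \<longlonglongrightarrow> 0"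
    and b: "\<And>k. b k \<in> Linf" "(\<lambda>k. \<pi> (b k) \<phi>) \<longlonglongrightarrow> x" "(\<lambda>k. sqnorm (\<lambda>z. \<eta> z - b k z)) \<longlonglongrightarrow> 0"
    using assms unfolding represents_def by blast
  have [measurable]: "\<xi> \<in> borel_measurable circle_measure" "\<eta> \<in> borel_measurable circle_measure"
    "a k \<in> borel_measurable circle_measure" "b k \<in> borel_measurable circle_measure" for k
    using assms a(1) b(1) by (auto simp: represents_def square_integrable_iff_sqnorm Linf_measurable)
  have "(\<lambda>k. \<pi> (a k) \<phi> - U (\<pi> (b k) \<phi>)) \<longlonglongrightarrow> U x - U x"
    by (intro tendsto_diff a(2) bounded_linear.tendsto[OF U_linear] b(2))
  then have "(\<lambda>k. ennreal ((norm (\<pi> (a k) \<phi> - U (\<pi> (b k) \<phi>)))\<^sup>2)) \<longlonglongrightarrow> ennreal ((norm (U x - U x))\<^sup>2)"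
    by (intro tendsto_ennrealI tendsto_power tendsto_norm)
  then have mid: "(\<lambda>k. sqnorm (\<lambda>z. a k z - filter_op (b k) z)) \<longlonglongrightarrow> 0"
    using a(1) b(1) by (simp add: norm_rep_cyclic_diff filter_op_Linf U_rep_cyclic)
  have tail: "sqnorm (\<lambda>z. filter_op (b k) z - filter_op \<eta> z) = sqnorm (\<lambda>z. \<eta> z - b k z)" for k
  proof -
    have "sqnorm (\<lambda>z. filter_op (b k) z - filter_op \<eta> z) = sqnorm (filter_op (\<lambda>z. \<eta> z - b k z))"
      unfolding filter_op_diff by (simp add: sqnorm_def norm_minus_commute)
    then show ?thesis by (simp add: sqnorm_filter_op)
  qed
  have bound: "sqnorm (\<lambda>z. \<xi> z - filter_op \<eta> z)
      \<le> 2 * sqnorm (\<lambda>z. \<xi> z - a k z)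
        + 2 * (2 * sqnorm (\<lambda>z. a k z - filter_op (b k) z) + 2 * sqnorm (\<lambda>z. \<eta> z - b k z))" for k
  proof -
    have "sqnorm (\<lambda>z. (\<xi> z - a k z) + ((a k z - filter_op (b k) z) + (filter_op (b k) z - filter_op \<eta> z)))
        \<le> 2 * sqnorm (\<lambda>z. \<xi> z - a k z)
          + 2 * sqnorm (\<lambda>z. (a k z - filter_op (b k) z) + (filter_op (b k) z - filter_op \<eta> z))"
      by (rule sqnorm_add_le) measurable
    also have "\<dots> \<le> 2 * sqnorm (\<lambda>z. \<xi> z - a k z)
        + 2 * (2 * sqnorm (\<lambda>z. a k z - filter_op (b k) z) + 2 * sqnorm (\<lambda>z. filter_op (b k) z - filter_op \<eta> z))"
      by (intro add_mono mult_left_mono order_refl sqnorm_add_le) measurable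
    finally show ?thesis by (simp add: tail)
  qed
  have "(\<lambda>k. 2 * sqnorm (\<lambda>z. \<xi> z - a k z)
        + 2 * (2 * sqnorm (\<lambda>z. a k z - filter_op (b k) z) + 2 * sqnorm (\<lambda>z. \<eta> z - b k z)))
      \<longlonglongrightarrow> 2 * 0 + 2 * (2 * 0 + 2 * 0)"
    by (intro tendsto_add ennreal_tendsto_cmult a(3) b(3) mid) auto
  then have "(\<lambda>k::nat. sqnorm (\<lambda>z. \<xi> z - filter_op \<eta> z)) \<longlonglongrightarrow> 0"
    by (intro tendsto_0_le_ennreal[OF always_eventually[OF allI[OF bound]]]) simp
  then have "sqnorm (\<lambda>z. \<xi> z - filter_op \<eta> z) = 0"
    by (simp add: LIMSEQ_const_iff)
  then show ?thesis by (subst (asm) sqnorm_eq_0_iff) auto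
qed

lemma represents_zero:
  assumes "represents \<xi> x" "AE z in weighted h. \<xi> z = 0"
  shows "x = 0"
proof -
  obtain g where g: "\<And>k. g k \<in> Linf" "(\<lambda>k. \<pi> (g k) \<phi>) \<longlonglongrightarrow> x" "(\<lambda>k. sqnorm (\<lambda>z. \<xi> z - g k z)) \<longlonglongrightarrow> 0"
    using assms unfolding represents_def by blast
  have "sqnorm (\<lambda>z. \<xi> z - g k z) = ennreal ((norm (\<pi> (g k) \<phi>))\<^sup>2)" for k
  proof -
    have "sqnorm (\<lambda>z. \<xi> z - g k z) = sqnorm (\<lambda>z. - g k z)"
      using assms(2) by (intro sqnorm_cong_AE) (auto elim!: eventually_mono)
    then show ?thesis using norm_rep_cyclic[OF g(1)] by (simp add: sqnorm_def)
  qed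
  with g(3) have "(\<lambda>k. (norm (\<pi> (g k) \<phi>))\<^sup>2) \<longlonglongrightarrow> 0"
    by (simp add: ennreal_tendsto_0_iff)
  moreover have "(\<lambda>k. (norm (\<pi> (g k) \<phi>))\<^sup>2) \<longlonglongrightarrow> (norm x)\<^sup>2"
    by (intro tendsto_intros g(2))
  ultimately have "(norm x)\<^sup>2 = 0" by (rule LIMSEQ_unique[symmetric])
  then show ?thesis by simp
qed

text \<open>Functions representing the preimages of a vector under the powers of \<open>U\<close> form a backward
orbit.\<close>

theorem Inter_U_V0: "(\<Inter>n\<in>{1..}. (U ^^ n) ` V0 \<pi> \<phi>) = {0}"
proof (intro equalityI subsetI)
  fix x assume x: "x \<in> (\<Inter>n\<in>{1..}. (U ^^ n) ` V0 \<pi> \<phi>)"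
  have "\<exists>y. y \<in> V0 \<pi> \<phi> \<and> x = (U ^^ Suc n) y" for n
    using INT_D[OF x, of "Suc n"] by auto
  then obtain y where y: "\<And>n. y n \<in> V0 \<pi> \<phi>" and x_eq: "\<And>n. x = (U ^^ Suc n) (y n)" by metis
  have step: "y n = U (y (Suc n))" for n
  proof -
    have "(U ^^ Suc n) (y n) = (U ^^ Suc n) (U (y (Suc n)))"
      using x_eq[of n] x_eq[of "Suc n"] by (simp add: funpow_swap1)
    then show ?thesis using inj_fn[OF U_inj] by (rule injD[rotated])
  qed
  have "\<exists>\<xi>. represents \<xi> (y n)" for n
    by (rule V0_represented[OF y[of n]]) blast
  then obtain \<xi> where \<xi>: "\<And>n. represents (\<xi> n) (y n)" by metis
  have "AE z in weighted h. \<xi> n z = m0 z * \<xi> (Suc n) (z ^ N)" for n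
    using represents_U[of "\<xi> n" "y (Suc n)" "\<xi> (Suc n)"] \<xi>[of n] \<xi>[of "Suc n"] step[of n]
    by (simp add: filter_op_def)
  moreover have "\<xi> n \<in> square_integrable h" for n
    using \<xi>[of n] by (simp add: represents_def)
  ultimately have "AE z in weighted h. \<xi> 0 z = 0"
    by (intro backward_orbit_vanishes)
  then have "y 0 = 0" by (rule represents_zero[OF \<xi>])
  then show "x \<in> {0}"
    using x_eq[of 0] by (simp add: linear_0[OF bounded_linear.linear[OF U_linear]])
next
  fix x :: 'v assume "x \<in> {0}"
  have zero: "(U ^^ n) 0 = 0" for n
    by (induction n) (simp_all add: linear_0[OF bounded_linear.linear[OF U_linear]])
  interpret V: vector_space "scaleC :: complex \<Rightarrow> 'v \<Rightarrow> 'v" by (rule vector_space_scaleC)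
  have "0 \<in> V0 \<pi> \<phi>"
    unfolding V0_def using V.span_zero closure_subset by blast
  then have "0 \<in> (U ^^ n) ` V0 \<pi> \<phi>" for n
    using zero by (metis image_eqI)
  then show "x \<in> (\<Inter>n\<in>{1..}. (U ^^ n) ` V0 \<pi> \<phi>)" using \<open>x \<in> {0}\<close> by simp
qed

end

section \<open>Triviality of the intersections\<close>

theorem theorem5p6:
  fixes N :: nat and m0 :: "complex \<Rightarrow> complex" and h :: "complex \<Rightarrow> real"
  assumes "N \<ge> 2"
    and "wavelet_filter N m0"
    and "nonsingular m0"
    and "integrable circle_measure h"
    and "AE z in circle_measure. h z \<ge> 0"
    and "\<not> (AE z in circle_measure. h z = 0)"
    and "AE z in circle_measure. ruelle N m0 h z = h z"
  shows "(\<Inter>n\<in>{1..}. (S0 N m0 h ^^ n) ` L2 h) = {L2_class h (\<lambda>z. 0)} \<and>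
    (\<forall>(\<pi> :: (complex \<Rightarrow> complex) \<Rightarrow> 'v::complex_hilbert_space \<Rightarrow> 'v) U \<phi>.
       induced_cyclic_representation N m0 h \<pi> U \<phi> \<longrightarrow>
       (\<Inter>n\<in>{1..}. (U ^^ n) ` V0 \<pi> \<phi>) = {0})"
proof -
  interpret harmonic_filter N m0 h
    using assms by unfold_locales
  show ?thesis
  proof (intro conjI allI impI)
    show "(\<Inter>n\<in>{1..}. (S0 N m0 h ^^ n) ` L2 h) = {L2_class h (\<lambda>z. 0)}"
      by (rule Inter_S0_range)
  next
    fix \<pi> :: "(complex \<Rightarrow> complex) \<Rightarrow> 'v \<Rightarrow> 'v" and U \<phi>
    assume "induced_cyclic_representation N m0 h \<pi> U \<phi>"
    then interpret harmonic_representation N m0 h \<pi> U \<phi>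
      by (intro harmonic_representation.intro harmonic_filter_axioms)
    show "(\<Inter>n\<in>{1..}. (U ^^ n) ` V0 \<pi> \<phi>) = {0}"
      by (rule Inter_U_V0)
  qed
qed

end
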